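(* Let $\mathcal{C}$ be a small category, let $\hat{\mathcal{C}}$ be its category of fractions, let $\Sigma_*(\hat{\mathcal{C}})$ be the nerve of $\hat{\mathcal{C}}$ (regarded as a symmetric simplicial set), and let $\tilde\Sigma_*(\mathcal{C})$ be the symmetric simplicial set whose $n$-simplices are the functors from the poset of non-empty subsets of $\{0,1,\dots,n\}$ to $\mathcal{C}$. Then the homotopy groupoids of $\Sigma_*(\hat{\mathcal{C}})$ and $\tilde\Sigma_*(\mathcal{C})$ are isomorphic.
   Context: Category of fractions: $\hat{\mathcal C}$ is the groupoid obtained from $\mathcal{C}$ by formally inverting all arrows; it has the same objects as $\mathcal C$, and its arrows are classes of composable strings of arrows of $\mathcal{C}$ and of $\mathcal{C}^{\circ}$ (opposite category), modulo composing adjacent arrows of $\mathcal{C}$, composing adjacent arrows of $\mathcal{C}^\circ$, and cancelling an adjacent arrow and its formal inverse. Nerve: $\Sigma_*(\mathcal{D})$ denotes the usual nerve of a category $\mathcal{D}$. $0$-simplices are objects; $1$-simplices are arrows $b$ with source $\partial_1 b$ and target $\partial_0 b$; a $2$-simplex $c$ is given by three arrows with $\partial_0c\,\partial_2c=\partial_1c$. When $\mathcal{D}$ is a groupoid, the nerve is in a natural way a symmetric simplicial set. Symmetric simplicial set: a contravariant functor to sets from the category with objects the sets $\{0,\dots,n\}$ and morphisms all maps between them. Face maps $\partial_i$ are induced by the injections omitting $i$; the generators also include permutations $\tau_i$ of adjacent vertices. The simplicial set $\tilde\Sigma_*(\mathcal{C})$: let $P$ be the poset of non-empty subsets of $\{0,\dots,n\}$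 ordered by inclusion, regarded as a category. An $n$-simplex is a functor $P\to\mathcal{C}$; any map $\{0,\dots,m\}\to\{0,\dots,n\}$ acts by taking images of subsets and precomposing. A $1$-simplex is thus a pair $(b_0,b_1)$ of arrows of $\mathcal C$ with a common target, whose $0$-face is the source of $b_0$ and whose $1$-face is the source of $b_1$. Homotopy groupoid of a symmetric simplicial set: a path is an expression $p=b_n*\cdots*b_1$ where the $b_i$ are $1$-simplices with $\partial_0b_i=\partial_1b_{i+1}$; $\partial_1p:=\partial_1b_1$, $\partial_0p:=\partial_0b_n$. Homotopy is the equivalence relation on paths generated by replacing, anywhere in a path, $\partial_1c$ by $\partial_0c*\partial_2c$ for a $2$-simplex $c$. The homotopy groupoid has the $0$-simplices as objects and homotopy classes of paths $p$ as arrows from $\partial_1p$ to $\partial_0p$, with composition induced by concatenation; classes of degenerate $1$-simplices are the units and the inverse of the class of $b$ is the class of its reverse $\tau_0b$. *)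

theory Defs
  imports Main "HOL-Library.FuncSet"
begin

section \<open>Small categories, groupoids and functors\<close>

text \<open>Smallness is automatic, since objects and arrows form sets. \<open>Comp C g f\<close> is
  \<open>g\<close> after \<open>f\<close>; it is only meaningful when \<open>Dom C g = Cod C f\<close>.\<close>

record ('o, 'a) precategory =
  Obj :: "'o set"
  Arr :: "'a set"
  Dom :: "'a \<Rightarrow> 'o"
  Cod :: "'a \<Rightarrow> 'o"
  Id :: "'o \<Rightarrow> 'a"
  Comp :: "'a \<Rightarrow> 'a \<Rightarrow> 'a"

locale category =
  fixes C :: "('o, 'a) precategory"
  assumes Dom_closed: "f \<in> Arr C \<Longrightarrow> Dom C f \<in> Obj C"
    and Cod_closed: "f \<in> Arr C \<Longrightarrow> Cod C f \<in> Obj C"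
    and Id_closed: "x \<in> Obj C \<Longrightarrow> Id C x \<in> Arr C"
    and Dom_Id: "x \<in> Obj C \<Longrightarrow> Dom C (Id C x) = x"
    and Cod_Id: "x \<in> Obj C \<Longrightarrow> Cod C (Id C x) = x"
    and Comp_closed: "\<lbrakk>f \<in> Arr C; g \<in> Arr C; Dom C g = Cod C f\<rbrakk> \<Longrightarrow> Comp C g f \<in> Arr C"
    and Dom_Comp: "\<lbrakk>f \<in> Arr C; g \<in> Arr C; Dom C g = Cod C f\<rbrakk> \<Longrightarrow> Dom C (Comp C g f) = Dom C f"
    and Cod_Comp: "\<lbrakk>f \<in> Arr C; g \<in> Arr C; Dom C g = Cod C f\<rbrakk> \<Longrightarrow> Cod C (Comp C g f) = Cod C g"
    and Comp_Id_right: "f \<in> Arr C \<Longrightarrow> Comp C f (Id C (Dom C f)) = f"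
    and Comp_Id_left: "f \<in> Arr C \<Longrightarrow> Comp C (Id C (Cod C f)) f = f"
    and Comp_assoc: "\<lbrakk>f \<in> Arr C; g \<in> Arr C; h \<in> Arr C; Dom C g = Cod C f; Dom C h = Cod C g\<rbrakk>
      \<Longrightarrow> Comp C h (Comp C g f) = Comp C (Comp C h g) f"

definition inverse_arrows :: "('o, 'a) precategory \<Rightarrow> 'a \<Rightarrow> 'a \<Rightarrow> bool" where
  "inverse_arrows C f g \<longleftrightarrow> f \<in> Arr C \<and> g \<in> Arr C \<and> Dom C g = Cod C f \<and> Cod C g = Dom C f \<and>
     Comp C g f = Id C (Dom C f) \<and> Comp C f g = Id C (Cod C f)"

locale groupoid = category C for C :: "('o, 'a) precategory" +
  assumes inverse_exists: "f \<in> Arr C \<Longrightarrow> \<exists>g. inverse_arrows C f g"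

definition inv_arr :: "('o, 'a) precategory \<Rightarrow> 'a \<Rightarrow> 'a" where
  "inv_arr C f = (THE g. inverse_arrows C f g)"

text \<open>A functor is a pair of an object map and an arrow map. The maps are required to be
  extensional (\<open>undefined\<close> outside the source category), so that two functors are equal
  as elements of the type iff they are equal as functors.\<close>

definition functors ::
    "('o, 'a) precategory \<Rightarrow> ('p, 'b) precategory \<Rightarrow> (('o \<Rightarrow> 'p) \<times> ('a \<Rightarrow> 'b)) set" where
  "functors A B = {(Fo, Fa). Fo \<in> Obj A \<rightarrow>\<^sub>E Obj B \<and> Fa \<in> Arr A \<rightarrow>\<^sub>E Arr B \<and>
     (\<forall>f\<in>Arr A. Dom B (Fa f) = Fo (Dom A f) \<and> Cod B (Fa f) = Fo (Cod A f)) \<and>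
     (\<forall>x\<in>Obj A. Fa (Id A x) = Id B (Fo x)) \<and>
     (\<forall>f\<in>Arr A. \<forall>g\<in>Arr A. Dom A g = Cod A f \<longrightarrow> Fa (Comp A g f) = Comp B (Fa g) (Fa f))}"

lemma functorsD:
  assumes "F \<in> functors A B"
  shows "fst F \<in> extensional (Obj A)" "snd F \<in> extensional (Arr A)"
    "x \<in> Obj A \<Longrightarrow> fst F x \<in> Obj B" "f \<in> Arr A \<Longrightarrow> snd F f \<in> Arr B"
    "f \<in> Arr A \<Longrightarrow> Dom B (snd F f) = fst F (Dom A f)"
    "f \<in> Arr A \<Longrightarrow> Cod B (snd F f) = fst F (Cod A f)"
    "x \<in> Obj A \<Longrightarrow> snd F (Id A x) = Id B (fst F x)"
    "\<lbrakk>f \<in> Arr A; g \<in> Arr A; Dom A g = Cod A f\<rbrakk>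
      \<Longrightarrow> snd F (Comp A g f) = Comp B (snd F g) (snd F f)"
  using assms by (auto simp: functors_def PiE_def)

definition isomorphic_groupoids ::
    "('o, 'a) precategory \<Rightarrow> ('p, 'b) precategory \<Rightarrow> bool" where
  "isomorphic_groupoids A B \<longleftrightarrow> groupoid A \<and> groupoid B \<and>
     (\<exists>(Fo, Fa) \<in> functors A B. bij_betw Fo (Obj A) (Obj B) \<and> bij_betw Fa (Arr A) (Arr B))"

definition order_category :: "'x set \<Rightarrow> ('x \<Rightarrow> 'x \<Rightarrow> bool) \<Rightarrow> ('x, 'x \<times> 'x) precategory" where
  "order_category S le = \<lparr>Obj = S, Arr = {(x, y). x \<in> S \<and> y \<in> S \<and> le x y},
     Dom = fst, Cod = snd, Id = (\<lambda>x. (x, x)), Comp = (\<lambda>g f. (fst f, snd g))\<rparr>"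

lemma functors_order:
  assumes "F \<in> functors (order_category S le) B"
  shows "x \<in> S \<Longrightarrow> fst F x \<in> Obj B"
    "\<lbrakk>x \<in> S; y \<in> S; le x y\<rbrakk> \<Longrightarrow> snd F (x, y) \<in> Arr B"
    "\<lbrakk>x \<in> S; y \<in> S; le x y\<rbrakk> \<Longrightarrow> Dom B (snd F (x, y)) = fst F x"
    "\<lbrakk>x \<in> S; y \<in> S; le x y\<rbrakk> \<Longrightarrow> Cod B (snd F (x, y)) = fst F y"
    "x \<in> S \<Longrightarrow> snd F (x, x) = Id B (fst F x)"
    "\<lbrakk>x \<in> S; y \<in> S; z \<in> S; le x y; le y z\<rbrakk>
      \<Longrightarrow> snd F (x, z) = Comp B (snd F (y, z)) (snd F (x, y))"
  using functorsD[OF assms, unfolded order_category_def]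
    functorsD(8)[OF assms, of "(x, y)" "(y, z)", unfolded order_category_def]
  by auto

lemma functors_orderI:
  assumes "Fo \<in> extensional S" "Fa \<in> extensional {(x, y). x \<in> S \<and> y \<in> S \<and> le x y}"
    and "\<And>x. x \<in> S \<Longrightarrow> Fo x \<in> Obj B \<and> Fa (x, x) = Id B (Fo x)"
    and "\<And>x y. \<lbrakk>x \<in> S; y \<in> S; le x y\<rbrakk> \<Longrightarrow>
      Fa (x, y) \<in> Arr B \<and> Dom B (Fa (x, y)) = Fo x \<and> Cod B (Fa (x, y)) = Fo y"
    and "\<And>x y z. \<lbrakk>x \<in> S; y \<in> S; z \<in> S; le x y; le y z\<rbrakk> \<Longrightarrow>
      Fa (x, z) = Comp B (Fa (y, z)) (Fa (x, y))"
  shows "(Fo, Fa) \<in> functors (order_category S le) B"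
  using assms(1,2) unfolding functors_def PiE_def order_category_def
  by (auto simp: assms(3,4) intro: assms(5))

text \<open>Arrows are classes of elements of \<open>S\<close> under \<open>E\<close>; the source and target functions
  \<open>s\<close> and \<open>t\<close>, the unit \<open>u\<close> and the concatenation \<open>k p q\<close> (\<open>p\<close> first, then \<open>q\<close>) are
  carried over to classes by means of representatives. The locale
  \<open>path_congruence\<close> below gives conditions under which the choice of representatives
  does not matter.\<close>

definition quotient_category ::
    "'o set \<Rightarrow> 'p set \<Rightarrow> ('p \<times> 'p) set \<Rightarrow> ('p \<Rightarrow> 'o) \<Rightarrow> ('p \<Rightarrow> 'o) \<Rightarrow> ('o \<Rightarrow> 'p) \<Rightarrow>
     ('p \<Rightarrow> 'p \<Rightarrow> 'p) \<Rightarrow> ('o, 'p set) precategory" where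
  "quotient_category Ob S E s t u k = \<lparr>Obj = Ob, Arr = S // E,
     Dom = (\<lambda>P. s (SOME p. p \<in> P)), Cod = (\<lambda>P. t (SOME p. p \<in> P)),
     Id = (\<lambda>x. E `` {u x}),
     Comp = (\<lambda>Q P. E `` {k (SOME p. p \<in> P) (SOME q. q \<in> Q)})\<rparr>"

locale path_congruence =
  fixes Ob :: "'o set" and S :: "'p set" and E :: "('p \<times> 'p) set"
    and s t :: "'p \<Rightarrow> 'o" and u :: "'o \<Rightarrow> 'p" and k :: "'p \<Rightarrow> 'p \<Rightarrow> 'p"
  assumes E: "equiv S E"
    and s_Ob: "p \<in> S \<Longrightarrow> s p \<in> Ob" and t_Ob: "p \<in> S \<Longrightarrow> t p \<in> Ob"
    and s_E: "(p, q) \<in> E \<Longrightarrow> s p = s q" and t_E: "(p, q) \<in> E \<Longrightarrow> t p = t q"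
    and u_S: "x \<in> Ob \<Longrightarrow> u x \<in> S" and s_u: "x \<in> Ob \<Longrightarrow> s (u x) = x"
    and t_u: "x \<in> Ob \<Longrightarrow> t (u x) = x"
    and k_S: "\<lbrakk>p \<in> S; q \<in> S; t p = s q\<rbrakk> \<Longrightarrow> k p q \<in> S"
    and s_k: "\<lbrakk>p \<in> S; q \<in> S; t p = s q\<rbrakk> \<Longrightarrow> s (k p q) = s p"
    and t_k: "\<lbrakk>p \<in> S; q \<in> S; t p = s q\<rbrakk> \<Longrightarrow> t (k p q) = t q"
    and k_E: "\<lbrakk>(p, p') \<in> E; (q, q') \<in> E; t p = s q\<rbrakk> \<Longrightarrow> (k p q, k p' q') \<in> E"
    and unit_left: "p \<in> S \<Longrightarrow> (k (u (s p)) p, p) \<in> E"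
    and unit_right: "p \<in> S \<Longrightarrow> (k p (u (t p)), p) \<in> E"
    and assoc: "\<lbrakk>p \<in> S; q \<in> S; r \<in> S; t p = s q; t q = s r\<rbrakk>
      \<Longrightarrow> (k (k p q) r, k p (k q r)) \<in> E"
    and inverse: "p \<in> S \<Longrightarrow> \<exists>q\<in>S. s q = t p \<and> t q = s p \<and>
      (k p q, u (s p)) \<in> E \<and> (k q p, u (t p)) \<in> E"
begin

abbreviation Q :: "('o, 'p set) precategory" where
  "Q \<equiv> quotient_category Ob S E s t u k"

lemma some_in_class: assumes "p \<in> S" shows "(p, SOME q. q \<in> E `` {p}) \<in> E"
proof -
  have "p \<in> E `` {p}" by (rule equiv_class_self[OF E assms])
  then have "(SOME q. q \<in> E `` {p}) \<in> E `` {p}" by (rule someI)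
  then show ?thesis by simp
qed

lemma E_S: "(p, q) \<in> E \<Longrightarrow> p \<in> S \<and> q \<in> S"
  using E by (auto simp: equiv_def)

lemma Obj_Q: "Obj Q = Ob" and Arr_Q: "Arr Q = S // E"
  and Id_Q: "Id Q x = E `` {u x}"
  by (simp_all add: quotient_category_def)

lemma Dom_class: "p \<in> S \<Longrightarrow> Dom Q (E `` {p}) = s p"
  and Cod_class: "p \<in> S \<Longrightarrow> Cod Q (E `` {p}) = t p"
  using some_in_class s_E t_E by (fastforce simp: quotient_category_def)+

lemma class_eq: "p \<in> S \<Longrightarrow> q \<in> S \<Longrightarrow> E `` {p} = E `` {q} \<longleftrightarrow> (p, q) \<in> E"
  using E by (simp add: eq_equiv_class_iff)

lemma Comp_class:
  assumes "p \<in> S" "q \<in> S" "t p = s q"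
  shows "Comp Q (E `` {q}) (E `` {p}) = E `` {k p q}"
proof -
  have "(k p q, k (SOME p'. p' \<in> E `` {p}) (SOME q'. q' \<in> E `` {q})) \<in> E"
    using assms by (intro k_E some_in_class)
  then have "E `` {k p q} = E `` {k (SOME p'. p' \<in> E `` {p}) (SOME q'. q' \<in> E `` {q})}"
    by (rule equiv_class_eq[OF E])
  then show ?thesis by (simp add: quotient_category_def)
qed

lemma class_in_Arr: "p \<in> S \<Longrightarrow> E `` {p} \<in> Arr Q"
  by (simp add: Arr_Q quotientI)

lemma inverse_classes:
  assumes "p \<in> S" "q \<in> S" "s q = t p" "t q = s p"
    "(k p q, u (s p)) \<in> E" "(k q p, u (t p)) \<in> E"
  shows "inverse_arrows Q (E `` {p}) (E `` {q})"
  using assms equiv_class_eq[OF E]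
  by (simp add: inverse_arrows_def class_in_Arr Dom_class Cod_class Comp_class Id_Q)

lemma groupoid_quotient: "groupoid Q"
proof
  fix f assume f: "f \<in> Arr Q"
  then obtain p where p: "p \<in> S" "f = E `` {p}" by (auto simp: Arr_Q elim: quotientE)
  show "Dom Q f \<in> Obj Q" "Cod Q f \<in> Obj Q"
    using p by (simp_all add: Dom_class Cod_class Obj_Q s_Ob t_Ob)
  show "Comp Q f (Id Q (Dom Q f)) = f" "Comp Q (Id Q (Cod Q f)) f = f"
    using p equiv_class_eq[OF E unit_left] equiv_class_eq[OF E unit_right]
    by (simp_all add: Dom_class Cod_class Id_Q Comp_class s_Ob t_Ob u_S s_u t_u)
  show "\<exists>g. inverse_arrows Q f g"
    using inverse[OF p(1)] p inverse_classes by blast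
  fix g assume "g \<in> Arr Q"
  then obtain q where q: "q \<in> S" "g = E `` {q}" by (auto simp: Arr_Q elim: quotientE)
  assume gf: "Dom Q g = Cod Q f"
  then have pq: "t p = s q" using p q by (simp add: Dom_class Cod_class)
  show "Comp Q g f \<in> Arr Q" "Dom Q (Comp Q g f) = Dom Q f" "Cod Q (Comp Q g f) = Cod Q g"
    using p q pq by (simp_all add: Comp_class class_in_Arr Dom_class Cod_class k_S s_k t_k)
  fix h assume "h \<in> Arr Q"
  then obtain r where r: "r \<in> S" "h = E `` {r}" by (auto simp: Arr_Q elim: quotientE)
  assume "Dom Q h = Cod Q g"
  then have qr: "t q = s r" using q r by (simp add: Dom_class Cod_class)
  show "Comp Q h (Comp Q g f) = Comp Q (Comp Q h g) f"
    using p q r pq qr equiv_class_eq[OF E assoc]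
    by (simp add: Comp_class k_S s_k t_k)
next
  fix x assume "x \<in> Obj Q"
  then have x: "x \<in> Ob" by (simp add: Obj_Q)
  then show "Id Q x \<in> Arr Q" "Dom Q (Id Q x) = x" "Cod Q (Id Q x) = x"
    by (simp_all add: Id_Q class_in_Arr Dom_class Cod_class u_S s_u t_u)
qed

end

lemma equiv_generated:
  "equiv S {(p, q). p \<in> S \<and> q \<in> S \<and> equivclp r p q}"
  by (rule equivI) (auto simp: refl_on_def sym_def trans_def intro: equivclp_sym equivclp_trans)

lemma equivclp_map:
  assumes "equivclp r p q" "P p"
    and "\<And>p q. r p q \<Longrightarrow> P p = P q"
    and "\<And>p q. \<lbrakk>r p q; P p\<rbrakk> \<Longrightarrow> r' (F p) (F q)"
  shows "equivclp r' (F p) (F q)"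
proof -
  from assms(1) have "P q \<and> equivclp r' (F p) (F q)"
  proof (induction rule: equivclp_induct)
    case base
    show ?case using assms(2) by simp
  next
    case (step y z)
    then have "P z" using assms(3) by blast
    moreover have "equivclp r' (F y) (F z)"
      using step assms(3,4) by (metis r_into_equivclp equivclp_sym)
    ultimately show ?case using step equivclp_trans by metis
  qed
  then show ?thesis ..
qed

lemma equivclp_invariant:
  assumes "equivclp r p q" and "\<And>p q. r p q \<Longrightarrow> F p = F q"
  shows "F p = F q"
  using assms(1) by (induction rule: equivclp_induct) (auto dest: assms(2))

section \<open>The category of fractions\<close>

text \<open>\<open>Fwd f\<close> stands for an arrow \<open>f\<close> of \<open>C\<close>, \<open>Bwd f\<close> for \<open>f\<close> as an arrow of the opposite
  category, that is, for the formal inverse of \<open>f\<close>.\<close>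

datatype 'a letter = Fwd 'a | Bwd 'a

fun letter_arr :: "'a letter \<Rightarrow> 'a" where
  "letter_arr (Fwd f) = f"
| "letter_arr (Bwd f) = f"

fun letter_dom :: "('o, 'a) precategory \<Rightarrow> 'a letter \<Rightarrow> 'o" where
  "letter_dom C (Fwd f) = Dom C f"
| "letter_dom C (Bwd f) = Cod C f"

fun letter_cod :: "('o, 'a) precategory \<Rightarrow> 'a letter \<Rightarrow> 'o" where
  "letter_cod C (Fwd f) = Cod C f"
| "letter_cod C (Bwd f) = Dom C f"

text \<open>Strings are listed in the order in which they are traversed, so the first letter of
  the list is the rightmost factor of the composite. The end points are recorded, since
  there is an empty string at every object.\<close>

fun composable :: "('o, 'a) precategory \<Rightarrow> 'o \<Rightarrow> 'a letter list \<Rightarrow> 'o \<Rightarrow> bool" where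
  "composable C x [] y \<longleftrightarrow> x \<in> Obj C \<and> y = x"
| "composable C x (l # w) y \<longleftrightarrow>
     letter_arr l \<in> Arr C \<and> letter_dom C l = x \<and> composable C (letter_cod C l) w y"

definition strings :: "('o, 'a) precategory \<Rightarrow> ('o \<times> 'a letter list \<times> 'o) set" where
  "strings C = {(x, w, y). composable C x w y}"

text \<open>No separate rule is needed for identities: \<open>[Fwd (Id C x)]\<close> is equivalent to the empty
  string at \<open>x\<close>, since \<open>Id C x\<close> is idempotent and can be cancelled.\<close>

inductive frac_step :: "('o, 'a) precategory \<Rightarrow> 'a letter list \<Rightarrow> 'a letter list \<Rightarrow> bool"
  for C where
  comp_fwd: "\<lbrakk>f \<in> Arr C; g \<in> Arr C; Dom C g = Cod C f\<rbrakk> \<Longrightarrow>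
     frac_step C (v @ [Fwd f, Fwd g] @ w) (v @ [Fwd (Comp C g f)] @ w)"
| comp_bwd: "\<lbrakk>f \<in> Arr C; g \<in> Arr C; Dom C g = Cod C f\<rbrakk> \<Longrightarrow>
     frac_step C (v @ [Bwd g, Bwd f] @ w) (v @ [Bwd (Comp C g f)] @ w)"
| cancel_fwd_bwd: "f \<in> Arr C \<Longrightarrow> frac_step C (v @ [Fwd f, Bwd f] @ w) (v @ w)"
| cancel_bwd_fwd: "f \<in> Arr C \<Longrightarrow> frac_step C (v @ [Bwd f, Fwd f] @ w) (v @ w)"

definition string_step ::
    "('o, 'a) precategory \<Rightarrow> 'o \<times> 'a letter list \<times> 'o \<Rightarrow> 'o \<times> 'a letter list \<times> 'o \<Rightarrow> bool" where
  "string_step C p q \<longleftrightarrow> p \<in> strings C \<and> q \<in> strings C \<and>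
     (\<exists>x v w y. p = (x, v, y) \<and> q = (x, w, y) \<and> frac_step C v w)"

definition frac_equiv ::
    "('o, 'a) precategory \<Rightarrow> (('o \<times> 'a letter list \<times> 'o) \<times> ('o \<times> 'a letter list \<times> 'o)) set" where
  "frac_equiv C = {(p, q). p \<in> strings C \<and> q \<in> strings C \<and> equivclp (string_step C) p q}"

definition fractions ::
    "('o, 'a) precategory \<Rightarrow> ('o, ('o \<times> 'a letter list \<times> 'o) set) precategory" where
  "fractions C = quotient_category (Obj C) (strings C) (frac_equiv C)
     (\<lambda>(x, w, y). x) (\<lambda>(x, w, y). y) (\<lambda>x. (x, [], x))
     (\<lambda>(x, v, y) (x', w, z). (x, v @ w, z))"

fun flip :: "'a letter \<Rightarrow> 'a letter" where
  "flip (Fwd f) = Bwd f"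
| "flip (Bwd f) = Fwd f"

context category
begin

lemma letter_ends:
  assumes "letter_arr l \<in> Arr C"
  shows "letter_dom C l \<in> Obj C" "letter_cod C l \<in> Obj C"
  using assms Dom_closed Cod_closed by (cases l; simp)+

lemma flip_simps:
  "letter_arr (flip l) = letter_arr l" "letter_dom C (flip l) = letter_cod C l"
  "letter_cod C (flip l) = letter_dom C l" "flip (flip l) = l"
  by (cases l; simp)+

lemma composable_Obj: "composable C x w y \<Longrightarrow> x \<in> Obj C \<and> y \<in> Obj C"
  by (induction w arbitrary: x) (auto simp: letter_ends)

lemma composable_append:
  "composable C x (v @ w) z \<longleftrightarrow> (\<exists>y. composable C x v y \<and> composable C y w z)"
  by (induction v arbitrary: x) (use composable_Obj in auto)

lemma composable_flip: "composable C x w y \<Longrightarrow> composable C y (rev (map flip w)) x"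
  by (induction w arbitrary: x) (auto simp: composable_append flip_simps letter_ends)

lemma frac_step_context:
  assumes "frac_step C v w" shows "frac_step C (a @ v @ b) (a @ w @ b)"
  using assms
proof cases
  case (comp_fwd f g v' w')
  then show ?thesis using frac_step.comp_fwd[of f C g "a @ v'" "w' @ b"] by simp
next
  case (comp_bwd f g v' w')
  then show ?thesis using frac_step.comp_bwd[of f C g "a @ v'" "w' @ b"] by simp
next
  case (cancel_fwd_bwd f v' w')
  then show ?thesis using frac_step.cancel_fwd_bwd[of f C "a @ v'" "w' @ b"] by simp
next
  case (cancel_bwd_fwd f v' w')
  then show ?thesis using frac_step.cancel_bwd_fwd[of f C "a @ v'" "w' @ b"] by simp
qed

lemma frac_equiv_context:
  assumes vw: "((x, v, y), (x', w, y')) \<in> frac_equiv C"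
    and a: "composable C x0 a x" and b: "composable C y b y0"
  shows "((x0, a @ v @ b, y0), (x0, a @ w @ b, y0)) \<in> frac_equiv C"
proof -
  have eq: "equivclp (string_step C) (x, v, y) (x', w, y')"
    using vw by (simp add: frac_equiv_def)
  let ?F = "\<lambda>(x :: 'o, v, y :: 'o). (x0, a @ v @ b, y0)"
  let ?P = "\<lambda>(x', v :: 'a letter list, y'). x' = x \<and> y' = y"
  have "equivclp (string_step C) (?F (x, v, y)) (?F (x', w, y'))"
    using eq
  proof (rule equivclp_map[where P = ?P])
    fix p q assume "string_step C p q"
    then show "?P p = ?P q" by (auto simp: string_step_def)
  next
    fix p q assume "string_step C p q" "?P p"
    then show "string_step C (?F p) (?F q)"
      using a b composable_append frac_step_context
      by (clarsimp simp: string_step_def strings_def) metis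
  qed simp
  moreover have "x' = x \<and> y' = y"
    using equivclp_invariant[OF eq, of "\<lambda>(x, w, y). (x, y)"] by (auto simp: string_step_def)
  ultimately show ?thesis
    using vw a b by (auto simp: frac_equiv_def strings_def composable_append)
qed

lemma frac_equiv_flip:
  assumes "composable C x w y"
  shows "((x, w @ rev (map flip w), x), (x, [], x)) \<in> frac_equiv C"
  using assms
proof (induction w arbitrary: x)
  case Nil
  then show ?case by (simp add: frac_equiv_def strings_def)
next
  case (Cons l w)
  define z where "z = letter_cod C l"
  have l: "letter_arr l \<in> Arr C" "letter_dom C l = x" and w: "composable C z w y"
    using Cons.prems by (auto simp: z_def)
  have c: "composable C x [l] z" "composable C z [flip l] x" and x: "x \<in> Obj C"
    using l by (auto simp: z_def flip_simps letter_ends)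
  have 1: "((x, [l] @ (w @ rev (map flip w)) @ [flip l], x), (x, [l] @ [] @ [flip l], x))
      \<in> frac_equiv C"
    by (rule frac_equiv_context[OF Cons.IH[OF w] c])
  have "frac_step C ([] @ [l, flip l] @ []) ([] @ [])"
    using l frac_step.cancel_fwd_bwd[of _ C "[]" "[]"] frac_step.cancel_bwd_fwd[of _ C "[]" "[]"]
    by (cases l) auto
  then have "string_step C (x, [l] @ [] @ [flip l], x) (x, [], x)"
    using c x by (auto simp: string_step_def strings_def flip_simps)
  then have 2: "((x, [l] @ [] @ [flip l], x), (x, [], x)) \<in> frac_equiv C"
    using r_into_equivclp[of "string_step C"] by (auto simp: frac_equiv_def string_step_def)
  show ?case using 1 2 by (auto simp: frac_equiv_def intro: equivclp_trans)
qed

lemma path_congruence_fractions: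
  "path_congruence (Obj C) (strings C) (frac_equiv C)
     (\<lambda>(x, w, y). x) (\<lambda>(x, w, y). y) (\<lambda>x. (x, [], x))
     (\<lambda>(x, v, y) (x', w, z). (x, v @ w, z))"
    (is "path_congruence _ _ _ ?s ?t ?u ?k")
proof
  show E: "equiv (strings C) (frac_equiv C)"
    unfolding frac_equiv_def by (rule equiv_generated)
  show "?s p = ?s q" "?t p = ?t q" if "(p, q) \<in> frac_equiv C" for p q
    using that equivclp_invariant[of "string_step C" p q ?s]
      equivclp_invariant[of "string_step C" p q ?t]
    by (auto simp: frac_equiv_def string_step_def)
  show "(?k p q, ?k p' q') \<in> frac_equiv C"
    if p: "(p, p') \<in> frac_equiv C" and q: "(q, q') \<in> frac_equiv C" and "?t p = ?s q"
    for p p' q q'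
  proof -
    obtain x v y x' v' y' where pv: "p = (x, v, y)" "p' = (x', v', y')"
      by (metis prod_cases3)
    obtain y1 w z y2 w' z' where qw: "q = (y1, w, z)" "q' = (y2, w', z')"
      by (metis prod_cases3)
    have inv: "x' = x" "y' = y" "y2 = y1" "z' = z" "y1 = y"
      using that pv qw equivclp_invariant[of "string_step C" p p' "\<lambda>(x, w, y). (x, y)"]
        equivclp_invariant[of "string_step C" q q' "\<lambda>(x, w, y). (x, y)"]
      by (auto simp: frac_equiv_def string_step_def)
    have c: "composable C x v' y" "composable C y w z" "x \<in> Obj C" "z \<in> Obj C"
      using p q composable_Obj by (auto simp: frac_equiv_def strings_def pv qw inv)
    have "((x, [] @ v @ w, z), (x, [] @ v' @ w, z)) \<in> frac_equiv C"
      using p c by (intro frac_equiv_context[where x = x and y = y]) (auto simp: pv inv)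
    moreover have "((x, v' @ w @ [], z), (x, v' @ w' @ [], z)) \<in> frac_equiv C"
      using q c by (intro frac_equiv_context[where x = y and y = z]) (auto simp: qw inv)
    ultimately show ?thesis
      using E by (auto simp: pv qw inv equiv_def elim: transE)
  qed
  show "\<exists>q\<in>strings C. ?s q = ?t p \<and> ?t q = ?s p \<and>
      (?k p q, ?u (?s p)) \<in> frac_equiv C \<and> (?k q p, ?u (?t p)) \<in> frac_equiv C"
    if pS: "p \<in> strings C" for p
  proof -
    obtain x w y where p: "p = (x, w, y)" and w: "composable C x w y"
      using pS by (auto simp: strings_def)
    have "rev (map flip (rev (map flip w))) = w"
      by (simp add: rev_map comp_def flip_simps)
    then show ?thesis
      using frac_equiv_flip[OF w] frac_equiv_flip[OF composable_flip[OF w]] composable_flip[OF w]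
      by (intro bexI[where x = "(y, rev (map flip w), x)"]) (auto simp: p strings_def)
  qed
qed (use composable_append composable_Obj in \<open>fastforce simp: strings_def frac_equiv_def\<close>)+

lemma groupoid_fractions: "groupoid (fractions C)"
  unfolding fractions_def by (rule path_congruence.groupoid_quotient[OF path_congruence_fractions])

end

section \<open>Symmetric simplicial sets\<close>

text \<open>\<open>act X m n f\<close> is the map from \<open>n\<close>-simplices to \<open>m\<close>-simplices induced by a map \<open>f\<close> from
  \<open>{..m}\<close> to \<open>{..n}\<close>; such maps are represented by extensional functions.\<close>

record 's sset =
  simp :: "nat \<Rightarrow> 's set"
  act :: "nat \<Rightarrow> nat \<Rightarrow> (nat \<Rightarrow> nat) \<Rightarrow> 's \<Rightarrow> 's"

locale symmetric_sset =
  fixes X :: "'s sset"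
  assumes act_closed: "\<lbrakk>f \<in> {..m} \<rightarrow>\<^sub>E {..n}; c \<in> simp X n\<rbrakk> \<Longrightarrow> act X m n f c \<in> simp X m"
    and act_id: "c \<in> simp X n \<Longrightarrow> act X n n (\<lambda>i\<in>{..n}. i) c = c"
    and act_comp: "\<lbrakk>f \<in> {..l} \<rightarrow>\<^sub>E {..m}; g \<in> {..m} \<rightarrow>\<^sub>E {..n}; c \<in> simp X n\<rbrakk>
      \<Longrightarrow> act X l n (compose {..l} g f) c = act X l m f (act X m n g c)"

definition face :: "'s sset \<Rightarrow> nat \<Rightarrow> nat \<Rightarrow> 's \<Rightarrow> 's" where
  "face X n i = act X (n - 1) n (\<lambda>j\<in>{..n - 1}. if j < i then j else Suc j)"

definition degen :: "'s sset \<Rightarrow> nat \<Rightarrow> nat \<Rightarrow> 's \<Rightarrow> 's" where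
  "degen X n i = act X (n + 1) n (\<lambda>j\<in>{..n + 1}. if j \<le> i then j else j - 1)"

definition swap :: "'s sset \<Rightarrow> nat \<Rightarrow> nat \<Rightarrow> 's \<Rightarrow> 's" where
  "swap X n i = act X n n (\<lambda>j\<in>{..n}. if j = i then Suc i else if j = Suc i then i else j)"

section \<open>The homotopy groupoid\<close>

text \<open>The path \<open>b\<^sub>n * \<dots> * b\<^sub>1\<close> is represented by the non-empty list \<open>[b\<^sub>1, \<dots>, b\<^sub>n]\<close>.\<close>

definition paths :: "'s sset \<Rightarrow> 's list set" where
  "paths X = {p. p \<noteq> [] \<and> set p \<subseteq> simp X 1 \<and>
     successively (\<lambda>b b'. face X 1 0 b = face X 1 1 b') p}"

definition path_source :: "'s sset \<Rightarrow> 's list \<Rightarrow> 's" where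
  "path_source X p = face X 1 1 (hd p)"

definition path_target :: "'s sset \<Rightarrow> 's list \<Rightarrow> 's" where
  "path_target X p = face X 1 0 (last p)"

definition homotopy_step :: "'s sset \<Rightarrow> 's list \<Rightarrow> 's list \<Rightarrow> bool" where
  "homotopy_step X p q \<longleftrightarrow> p \<in> paths X \<and> q \<in> paths X \<and>
     (\<exists>v w. \<exists>c\<in>simp X 2. p = v @ [face X 2 1 c] @ w \<and> q = v @ [face X 2 2 c, face X 2 0 c] @ w)"

definition homotopy :: "'s sset \<Rightarrow> ('s list \<times> 's list) set" where
  "homotopy X = {(p, q). p \<in> paths X \<and> q \<in> paths X \<and> equivclp (homotopy_step X) p q}"

definition homotopy_groupoid :: "'s sset \<Rightarrow> ('s, 's list set) precategory" where
  "homotopy_groupoid X = quotient_category (simp X 0) (paths X) (homotopy X)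
     (path_source X) (path_target X) (\<lambda>x. [degen X 0 0 x]) (@)"

text \<open>This is a groupoid for every symmetric simplicial set; the inverse of the class of a
  \<open>1\<close>-simplex \<open>b\<close> is the class of \<open>swap X 1 0 b\<close>.\<close>

context symmetric_sset
begin

context
  notes [simp del] = One_nat_def atMost_0
begin

lemma act_in: "\<lbrakk>c \<in> simp X n; \<And>j. j \<le> m \<Longrightarrow> f j \<le> n\<rbrakk> \<Longrightarrow> act X m n (restrict f {..m}) c \<in> simp X m"
  by (rule act_closed) auto

lemma act_act:
  assumes "c \<in> simp X n" "\<And>j. j \<le> l \<Longrightarrow> f j \<le> m" "\<And>j. j \<le> m \<Longrightarrow> g j \<le> n"
  shows "act X l m (restrict f {..l}) (act X m n (restrict g {..m}) c) =
    act X l n (\<lambda>j\<in>{..l}. g (f j)) c"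
proof -
  have "compose {..l} (restrict g {..m}) (restrict f {..l}) = (\<lambda>j\<in>{..l}. g (f j))"
    using assms(2) by (auto simp: compose_def fun_eq_iff)
  then show ?thesis
    using act_comp[of "restrict f {..l}" l m "restrict g {..m}" n c] assms by auto
qed

lemma act_cong:
  "(\<And>j. j \<le> m \<Longrightarrow> f j = g j) \<Longrightarrow> act X m n (restrict f {..m}) c = act X m n (restrict g {..m}) c"
  by (metis atMost_iff restrict_ext)

lemma face_in: "c \<in> simp X (n + 1) \<Longrightarrow> face X (n + 1) i c \<in> simp X n"
  unfolding face_def by simp (rule act_in; auto)

lemma face_in_2: "c \<in> simp X 2 \<Longrightarrow> face X 2 i c \<in> simp X 1"
  using face_in[of c 1] by (simp add: one_add_one)

lemma degen_in: "\<lbrakk>c \<in> simp X n; i \<le> n\<rbrakk> \<Longrightarrow> degen X n i c \<in> simp X (n + 1)"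
  unfolding degen_def by (rule act_in) auto

lemma degen_0_in: "x \<in> simp X 0 \<Longrightarrow> degen X 0 0 x \<in> simp X 1"
  using degen_in[of x 0] by simp

lemma swap_in: "b \<in> simp X 1 \<Longrightarrow> swap X 1 0 b \<in> simp X 1"
  unfolding swap_def by (rule act_in) auto

lemma act_eq_self:
  "\<lbrakk>c \<in> simp X n; \<And>j. j \<le> n \<Longrightarrow> f j = j\<rbrakk> \<Longrightarrow> act X n n (restrict f {..n}) c = c"
  using act_id[of c n] act_cong[of n f "\<lambda>j. j" n c] by simp

lemma face_1: "face X 1 i = act X 0 1 (\<lambda>j\<in>{..0}. if j < i then j else Suc j)"
  and face_2: "face X 2 i = act X 1 2 (\<lambda>j\<in>{..1}. if j < i then j else Suc j)"
  and degen_0: "degen X 0 0 = act X 1 0 (\<lambda>j\<in>{..1}. 0)"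
  by (auto simp: face_def degen_def One_nat_def intro!: arg_cong[where f = "act X (Suc 0) 0"])

lemma ends:
  "b \<in> simp X 1 \<Longrightarrow> face X 1 0 b \<in> simp X 0" "b \<in> simp X 1 \<Longrightarrow> face X 1 1 b \<in> simp X 0"
  using face_in[of b 0] by auto

lemma ends_degen:
  assumes "x \<in> simp X 0"
  shows "face X 1 0 (degen X 0 0 x) = x" "face X 1 1 (degen X 0 0 x) = x"
  using assms by (auto simp: face_1 degen_0 act_act intro!: act_eq_self)

lemma ends_swap:
  assumes "b \<in> simp X 1"
  shows "face X 1 0 (swap X 1 0 b) = face X 1 1 b" "face X 1 1 (swap X 1 0 b) = face X 1 0 b"
  using assms by (auto simp: face_1 swap_def act_act intro!: act_cong)

lemma faces_2:
  assumes "c \<in> simp X 2"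
  shows "face X 1 1 (face X 2 1 c) = face X 1 1 (face X 2 2 c)"
    "face X 1 0 (face X 2 1 c) = face X 1 0 (face X 2 0 c)"
    "face X 1 0 (face X 2 2 c) = face X 1 1 (face X 2 0 c)"
  using assms by (auto simp: face_1 face_2 act_act intro!: act_cong)

lemma swap_swap: "b \<in> simp X 1 \<Longrightarrow> swap X 1 0 (swap X 1 0 b) = b"
  unfolding swap_def by (subst act_act) (auto intro!: act_eq_self)

lemma paths_append:
  assumes "p \<noteq> []" "q \<noteq> []"
  shows "p @ q \<in> paths X \<longleftrightarrow> p \<in> paths X \<and> q \<in> paths X \<and> path_target X p = path_source X q"
  using assms by (auto simp: paths_def successively_append_iff path_source_def path_target_def)

lemma path_ends_append:
  "p \<noteq> [] \<Longrightarrow> path_source X (p @ q) = path_source X p"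
  "q \<noteq> [] \<Longrightarrow> path_target X (p @ q) = path_target X q"
  by (simp_all add: path_source_def path_target_def)

lemma path_singleton:
  "[b] \<in> paths X \<longleftrightarrow> b \<in> simp X 1"
  "path_source X [b] = face X 1 1 b" "path_target X [b] = face X 1 0 b"
  by (auto simp: paths_def path_source_def path_target_def)

lemma path_nonempty: "p \<in> paths X \<Longrightarrow> p \<noteq> []"
  by (simp add: paths_def)

lemma path_ends_in:
  assumes "p \<in> paths X"
  shows "path_source X p \<in> simp X 0" "path_target X p \<in> simp X 0"
  using assms hd_in_set[of p] last_in_set[of p]
  by (auto simp: paths_def path_source_def path_target_def intro!: ends)

lemma homotopy_paths: "(p, q) \<in> homotopy X \<Longrightarrow> p \<in> paths X \<and> q \<in> paths X"
  by (simp add: homotopy_def)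

lemma equiv_homotopy: "equiv (paths X) (homotopy X)"
  unfolding homotopy_def by (rule equiv_generated)

lemma homotopy_refl: "p \<in> paths X \<Longrightarrow> (p, p) \<in> homotopy X"
  by (simp add: homotopy_def)

lemma homotopy_sym: "(p, q) \<in> homotopy X \<Longrightarrow> (q, p) \<in> homotopy X"
  by (auto simp: homotopy_def intro: equivclp_sym)

lemma homotopy_trans [trans]:
  "\<lbrakk>(p, q) \<in> homotopy X; (q, r) \<in> homotopy X\<rbrakk> \<Longrightarrow> (p, r) \<in> homotopy X"
  by (auto simp: homotopy_def intro: equivclp_trans)

lemma homotopy_step_ends:
  assumes "homotopy_step X p q"
  shows "path_source X p = path_source X q" "path_target X p = path_target X q"
proof -
  obtain v w c where c: "c \<in> simp X 2" and p: "p = v @ [face X 2 1 c] @ w"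
    and q: "q = v @ [face X 2 2 c, face X 2 0 c] @ w"
    using assms by (auto simp: homotopy_step_def)
  show "path_source X p = path_source X q" "path_target X p = path_target X q"
    using faces_2[OF c] unfolding p q
    by (cases v; cases w rule: rev_cases; auto simp: path_source_def path_target_def)+
qed

lemma homotopy_ends:
  assumes "(p, q) \<in> homotopy X"
  shows "path_source X p = path_source X q" "path_target X p = path_target X q"
  using assms equivclp_invariant[of "homotopy_step X" p q] homotopy_step_ends
  by (auto simp: homotopy_def)

lemma homotopy_triangle:
  assumes "c \<in> simp X 2"
  shows "([face X 2 1 c], [face X 2 2 c, face X 2 0 c]) \<in> homotopy X"
proof -
  have 1: "[face X 2 1 c] \<in> paths X"
    using assms by (simp add: path_singleton face_in_2)
  have "[face X 2 2 c] @ [face X 2 0 c] \<in> paths X"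
    using assms faces_2 by (subst paths_append) (auto simp: path_singleton face_in_2)
  then have 2: "[face X 2 2 c, face X 2 0 c] \<in> paths X" by simp
  have "homotopy_step X [face X 2 1 c] [face X 2 2 c, face X 2 0 c]"
    unfolding homotopy_step_def using assms 1 2
    by (intro conjI exI[where x = "[]"] bexI[where x = c]) auto
  then show ?thesis using 1 2 by (auto simp: homotopy_def)
qed

lemma homotopy_append_left:
  assumes pq: "(p, q) \<in> homotopy X" and a: "a \<in> paths X" "path_target X a = path_source X p"
  shows "(a @ p, a @ q) \<in> homotopy X"
proof -
  have "equivclp (homotopy_step X) (a @ p) (a @ q)"
  proof (rule equivclp_map[where P = "\<lambda>p. path_target X a = path_source X p" and F = "\<lambda>p. a @ p"])
    show "equivclp (homotopy_step X) p q" using pq by (simp add: homotopy_def)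
  next
    fix p q assume s: "homotopy_step X p q" and e: "path_target X a = path_source X p"
    obtain v w c where c: "c \<in> simp X 2" and p: "p = v @ [face X 2 1 c] @ w"
      and q: "q = v @ [face X 2 2 c, face X 2 0 c] @ w" "p \<in> paths X" "q \<in> paths X"
      using s by (auto simp: homotopy_step_def)
    have "a @ p \<in> paths X" "a @ q \<in> paths X"
      using a q(2,3) e homotopy_step_ends[OF s] path_nonempty by (simp_all add: paths_append)
    moreover have "a @ p = (a @ v) @ [face X 2 1 c] @ w"
      "a @ q = (a @ v) @ [face X 2 2 c, face X 2 0 c] @ w"
      by (simp_all add: p q)
    ultimately show "homotopy_step X (a @ p) (a @ q)"
      unfolding homotopy_step_def using c by blast
  qed (use a homotopy_step_ends in auto)
  then show ?thesis
    using pq a homotopy_ends[OF pq] path_nonempty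
    by (auto simp: homotopy_def paths_append)
qed

lemma homotopy_append_right:
  assumes pq: "(p, q) \<in> homotopy X" and a: "a \<in> paths X" "path_target X p = path_source X a"
  shows "(p @ a, q @ a) \<in> homotopy X"
proof -
  have "equivclp (homotopy_step X) (p @ a) (q @ a)"
  proof (rule equivclp_map[where P = "\<lambda>p. path_target X p = path_source X a" and F = "\<lambda>p. p @ a"])
    show "equivclp (homotopy_step X) p q" using pq by (simp add: homotopy_def)
  next
    fix p q assume s: "homotopy_step X p q" and e: "path_target X p = path_source X a"
    obtain v w c where c: "c \<in> simp X 2" and p: "p = v @ [face X 2 1 c] @ w"
      and q: "q = v @ [face X 2 2 c, face X 2 0 c] @ w" "p \<in> paths X" "q \<in> paths X"
      using s by (auto simp: homotopy_step_def)
    have "p @ a \<in> paths X" "q @ a \<in> paths X"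
      using a q(2,3) e homotopy_step_ends[OF s] path_nonempty by (simp_all add: paths_append)
    moreover have "p @ a = v @ [face X 2 1 c] @ (w @ a)"
      "q @ a = v @ [face X 2 2 c, face X 2 0 c] @ (w @ a)"
      by (simp_all add: p q)
    ultimately show "homotopy_step X (p @ a) (q @ a)"
      unfolding homotopy_step_def using c by blast
  qed (use a homotopy_step_ends in auto)
  then show ?thesis
    using pq a homotopy_ends[OF pq] path_nonempty
    by (auto simp: homotopy_def paths_append)
qed

lemma homotopy_append:
  assumes "(p, p') \<in> homotopy X" "(q, q') \<in> homotopy X" "path_target X p = path_source X q"
  shows "(p @ q, p' @ q') \<in> homotopy X"
proof -
  have "(p @ q, p' @ q) \<in> homotopy X"
    using assms homotopy_paths by (blast intro: homotopy_append_right)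
  also have "(p' @ q, p' @ q') \<in> homotopy X"
    using assms homotopy_paths homotopy_ends by (metis homotopy_append_left)
  finally show ?thesis .
qed

lemma homotopy_unit_1:
  assumes b: "b \<in> simp X 1"
  shows "([degen X 0 0 (face X 1 1 b), b], [b]) \<in> homotopy X"
    "([b, degen X 0 0 (face X 1 0 b)], [b]) \<in> homotopy X"
proof -
  let ?l = "act X 2 1 (\<lambda>j\<in>{..2}. if j = 2 then 1 else 0) b"
  have l: "?l \<in> simp X 2" using b by (intro act_in) auto
  have "face X 2 1 ?l = b" "face X 2 0 ?l = b"
    using b by (auto simp: face_2 act_act intro!: act_eq_self)
  moreover have "face X 2 2 ?l = degen X 0 0 (face X 1 1 b)"
    using b by (auto simp: face_1 face_2 degen_0 act_act intro!: act_cong)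
  ultimately show "([degen X 0 0 (face X 1 1 b), b], [b]) \<in> homotopy X"
    using homotopy_sym[OF homotopy_triangle[OF l]] by simp
  let ?r = "act X 2 1 (\<lambda>j\<in>{..2}. if j = 0 then 0 else 1) b"
  have r: "?r \<in> simp X 2" using b by (intro act_in) auto
  have "face X 2 1 ?r = b" "face X 2 2 ?r = b"
    using b by (auto simp: face_2 act_act intro!: act_eq_self)
  moreover have "face X 2 0 ?r = degen X 0 0 (face X 1 0 b)"
    using b by (auto simp: face_1 face_2 degen_0 act_act intro!: act_cong)
  ultimately show "([b, degen X 0 0 (face X 1 0 b)], [b]) \<in> homotopy X"
    using homotopy_sym[OF homotopy_triangle[OF r]] by simp
qed

lemma homotopy_inverse_1:
  assumes b: "b \<in> simp X 1"
  shows "([b, swap X 1 0 b], [degen X 0 0 (face X 1 1 b)]) \<in> homotopy X"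
proof -
  let ?c = "act X 2 1 (\<lambda>j\<in>{..2}. if j = 1 then 1 else 0) b"
  have c: "?c \<in> simp X 2" using b by (intro act_in) auto
  have "face X 2 2 ?c = b"
    using b by (auto simp: face_2 act_act intro!: act_eq_self)
  moreover have "face X 2 0 ?c = swap X 1 0 b"
    using b by (auto simp: face_2 swap_def act_act intro!: act_cong)
  moreover have "face X 2 1 ?c = degen X 0 0 (face X 1 1 b)"
    using b by (auto simp: face_1 face_2 degen_0 act_act intro!: act_cong)
  ultimately show ?thesis
    using homotopy_sym[OF homotopy_triangle[OF c]] by simp
qed

lemma homotopy_unit_left:
  assumes "p \<in> paths X"
  shows "([degen X 0 0 (path_source X p)] @ p, p) \<in> homotopy X"
proof -
  obtain b q where p: "p = [b] @ q" using path_nonempty[OF assms] by (cases p) auto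
  show ?thesis
  proof (cases "q = []")
    case True
    then show ?thesis using assms homotopy_unit_1(1)[of b] by (simp add: p path_singleton)
  next
    case False
    then have bq: "b \<in> simp X 1" "q \<in> paths X" "path_target X [b] = path_source X q"
      using assms paths_append[of "[b]" q] by (simp_all add: p path_singleton)
    have "([degen X 0 0 (face X 1 1 b), b] @ q, [b] @ q) \<in> homotopy X"
      using bq homotopy_unit_1(1)[of b]
      by (intro homotopy_append_right) (auto simp: path_target_def)
    then show ?thesis by (simp add: p path_source_def)
  qed
qed

lemma homotopy_unit_right:
  assumes "p \<in> paths X"
  shows "(p @ [degen X 0 0 (path_target X p)], p) \<in> homotopy X"
proof -
  obtain b q where p: "p = q @ [b]" using path_nonempty[OF assms] by (cases p rule: rev_cases) auto
  show ?thesis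
  proof (cases "q = []")
    case True
    then show ?thesis using assms homotopy_unit_1(2)[of b] by (simp add: p path_singleton)
  next
    case False
    then have bq: "b \<in> simp X 1" "q \<in> paths X" "path_target X q = path_source X [b]"
      using assms by (simp_all add: p paths_append path_singleton)
    have "(q @ [b, degen X 0 0 (face X 1 0 b)], q @ [b]) \<in> homotopy X"
      using bq homotopy_unit_1(2)[of b]
      by (intro homotopy_append_left) (auto simp: path_source_def)
    then show ?thesis by (simp add: p path_target_def)
  qed
qed

definition reverse :: "'s list \<Rightarrow> 's list" where
  "reverse p = rev (map (swap X 1 0) p)"

lemma reverse_path:
  assumes "p \<in> paths X"
  shows "reverse p \<in> paths X" "path_source X (reverse p) = path_target X p"
    "path_target X (reverse p) = path_source X p" "reverse (reverse p) = p"
proof -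
  have p: "p \<noteq> []" "set p \<subseteq> simp X 1" "successively (\<lambda>b b'. face X 1 0 b = face X 1 1 b') p"
    using assms by (auto simp: paths_def)
  have "successively (\<lambda>b b'. face X 1 1 (swap X 1 0 b) = face X 1 0 (swap X 1 0 b')) p"
    by (rule successively_mono[OF p(3)]) (use p(2) in \<open>auto simp: ends_swap subset_iff\<close>)
  then show "reverse p \<in> paths X"
    using p swap_in by (auto simp: paths_def reverse_def successively_rev successively_map eq_commute)
  show "path_source X (reverse p) = path_target X p" "path_target X (reverse p) = path_source X p"
    using p hd_in_set[of p] last_in_set[of p]
    by (auto simp: reverse_def path_source_def path_target_def hd_rev last_rev last_map hd_map
        subset_iff ends_swap)
  have "map (\<lambda>b. swap X 1 0 (swap X 1 0 b)) p = p"
    using p(2) by (intro map_idI) (auto simp: swap_swap)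
  then show "reverse (reverse p) = p"
    by (simp add: reverse_def rev_map comp_def)
qed

lemma homotopy_inverse:
  assumes "p \<in> paths X"
  shows "(p @ reverse p, [degen X 0 0 (path_source X p)]) \<in> homotopy X"
  using assms
proof (induction p)
  case Nil
  then show ?case by (simp add: paths_def)
next
  case (Cons b p)
  show ?case
  proof (cases "p = []")
    case True
    then show ?thesis
      using Cons.prems homotopy_inverse_1[of b] by (simp add: path_singleton reverse_def)
  next
    case False
    let ?b = "swap X 1 0 b"
    have bp: "b \<in> simp X 1" "p \<in> paths X" "path_target X [b] = path_source X p"
      using Cons.prems False paths_append[of "[b]" p] by (simp_all add: path_singleton)
    have e: "path_source X p = face X 1 0 b" using bp by (simp add: path_singleton)
    have sb: "[?b] \<in> paths X" "path_source X [?b] = face X 1 0 b"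
      using bp by (simp_all add: path_singleton swap_in ends_swap)
    have "(p @ reverse p, [degen X 0 0 (face X 1 0 b)]) \<in> homotopy X"
      using Cons.IH bp e by simp
    then have "([b] @ (p @ reverse p), [b] @ [degen X 0 0 (face X 1 0 b)]) \<in> homotopy X"
      using bp by (intro homotopy_append_left) (auto simp: path_singleton path_ends_append path_nonempty)
    also have "([b] @ [degen X 0 0 (face X 1 0 b)], [b]) \<in> homotopy X"
      using homotopy_unit_1(2) bp by simp
    finally have "(([b] @ (p @ reverse p)) @ [?b], [b] @ [?b]) \<in> homotopy X"
      using sb bp False reverse_path[OF bp(2)] path_nonempty e
      by (intro homotopy_append_right) (auto simp: path_target_def)
    also have "([b] @ [?b], [degen X 0 0 (face X 1 1 b)]) \<in> homotopy X"
      using homotopy_inverse_1 bp by simp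
    finally show ?thesis by (simp add: reverse_def path_source_def)
  qed
qed

lemma path_congruence_homotopy:
  "path_congruence (simp X 0) (paths X) (homotopy X)
     (path_source X) (path_target X) (\<lambda>x. [degen X 0 0 x]) (@)"
proof
  show "\<exists>q\<in>paths X. path_source X q = path_target X p \<and> path_target X q = path_source X p \<and>
      (p @ q, [degen X 0 0 (path_source X p)]) \<in> homotopy X \<and>
      (q @ p, [degen X 0 0 (path_target X p)]) \<in> homotopy X"
    if "p \<in> paths X" for p
    using reverse_path[OF that] homotopy_inverse[OF that] homotopy_inverse[of "reverse p"]
    by (intro bexI[where x = "reverse p"]) auto
qed (auto simp: equiv_homotopy path_ends_in homotopy_ends path_singleton degen_0_in ends_degen
    paths_append path_nonempty path_ends_append homotopy_append
    homotopy_unit_left[simplified] homotopy_unit_right intro!: homotopy_refl)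

lemma groupoid_homotopy_groupoid: "groupoid (homotopy_groupoid X)"
  unfolding homotopy_groupoid_def
  by (rule path_congruence.groupoid_quotient[OF path_congruence_homotopy])

lemma inverse_homotopy_groupoid:
  assumes "b \<in> simp X 1"
  shows "inverse_arrows (homotopy_groupoid X) (homotopy X `` {[b]}) (homotopy X `` {[swap X 1 0 b]})"
  unfolding homotopy_groupoid_def
  using assms homotopy_inverse_1[OF assms] homotopy_inverse_1[OF swap_in[OF assms]]
  by (intro path_congruence.inverse_classes[OF path_congruence_homotopy])
    (auto simp: path_singleton swap_in ends_swap swap_swap)

end

end

section \<open>The nerve of a groupoid\<close>

text \<open>An \<open>n\<close>-simplex of the nerve of \<open>D\<close> is a functor to \<open>D\<close> from the ordered set
  \<open>{0, \<dots>, n}\<close>. Monotone maps act by precomposition. If \<open>D\<close> is a groupoid, such a functor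
  provides an arrow \<open>nerve_edge D F i j\<close> from its \<open>i\<close>-th to its \<open>j\<close>-th vertex for all
  \<open>i\<close> and \<open>j\<close>, by inverting the given ones, and in this way all maps act.\<close>

definition nerve_edge ::
    "('o, 'a) precategory \<Rightarrow> (nat \<Rightarrow> 'o) \<times> (nat \<times> nat \<Rightarrow> 'a) \<Rightarrow> nat \<Rightarrow> nat \<Rightarrow> 'a" where
  "nerve_edge D F i j = (if i \<le> j then snd F (i, j) else inv_arr D (snd F (j, i)))"

definition ordinal :: "nat \<Rightarrow> (nat, nat \<times> nat) precategory" where
  "ordinal n = order_category {..n} (\<le>)"

definition nerve ::
    "('o, 'a) precategory \<Rightarrow> ((nat \<Rightarrow> 'o) \<times> (nat \<times> nat \<Rightarrow> 'a)) sset" where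
  "nerve D = \<lparr>simp = (\<lambda>n. functors (ordinal n) D),
     act = (\<lambda>m n f F. (\<lambda>i\<in>Obj (ordinal m). fst F (f i),
                       \<lambda>(i, j)\<in>Arr (ordinal m). nerve_edge D F (f i) (f j)))\<rparr>"

context groupoid
begin

lemma inverse_arrows_unique:
  assumes g: "inverse_arrows C f g" and h: "inverse_arrows C f h" shows "g = h"
proof -
  have "g = Comp C g (Comp C f h)"
    using g h Comp_Id_right[of g] by (auto simp: inverse_arrows_def)
  also have "\<dots> = Comp C (Comp C g f) h"
    using g h by (intro Comp_assoc) (auto simp: inverse_arrows_def)
  also have "\<dots> = h"
    using g h Comp_Id_left[of h] by (auto simp: inverse_arrows_def)
  finally show ?thesis .
qed

lemma inv_arr_eq: "inverse_arrows C f g \<Longrightarrow> inv_arr C f = g"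
  unfolding inv_arr_def using inverse_arrows_unique by blast

lemma inverse_inv_arr: "f \<in> Arr C \<Longrightarrow> inverse_arrows C f (inv_arr C f)"
  using inverse_exists inv_arr_eq by metis

lemma inverse_arrows_sym: "inverse_arrows C f g \<Longrightarrow> inverse_arrows C g f"
  by (auto simp: inverse_arrows_def)

lemma inv_arr:
  assumes "f \<in> Arr C"
  shows "inv_arr C f \<in> Arr C" "Dom C (inv_arr C f) = Cod C f" "Cod C (inv_arr C f) = Dom C f"
    "Comp C (inv_arr C f) f = Id C (Dom C f)" "Comp C f (inv_arr C f) = Id C (Cod C f)"
    "inv_arr C (inv_arr C f) = f"
  using inverse_inv_arr[OF assms] inv_arr_eq[OF inverse_arrows_sym]
  by (auto simp: inverse_arrows_def)

lemma inv_arr_Id: "x \<in> Obj C \<Longrightarrow> inv_arr C (Id C x) = Id C x"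
  using Comp_Id_left[of "Id C x"]
  by (intro inv_arr_eq) (auto simp: inverse_arrows_def Id_closed Dom_Id Cod_Id)

lemma inv_arr_Comp:
  assumes "f \<in> Arr C" "g \<in> Arr C" "Dom C g = Cod C f"
  shows "inv_arr C (Comp C g f) = Comp C (inv_arr C f) (inv_arr C g)"
proof (rule inv_arr_eq)
  have *: "Comp C (Comp C a b) (Comp C (inv_arr C b) (inv_arr C a)) = Id C (Cod C a)"
    if "a \<in> Arr C" "b \<in> Arr C" "Dom C a = Cod C b" for a b
  proof -
    have "Comp C (Comp C a b) (Comp C (inv_arr C b) (inv_arr C a)) =
        Comp C a (Comp C b (Comp C (inv_arr C b) (inv_arr C a)))"
      using that by (intro Comp_assoc[symmetric]) (simp_all add: inv_arr Comp_closed Cod_Comp)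
    also have "Comp C b (Comp C (inv_arr C b) (inv_arr C a)) = inv_arr C a"
      using that Comp_Id_left[of "inv_arr C a"] by (subst Comp_assoc) (simp_all add: inv_arr)
    finally show ?thesis using that by (simp add: inv_arr)
  qed
  show "inverse_arrows C (Comp C g f) (Comp C (inv_arr C f) (inv_arr C g))"
    using assms *[of g f] *[of "inv_arr C f" "inv_arr C g"]
    by (simp add: inverse_arrows_def inv_arr Comp_closed Dom_Comp Cod_Comp)
qed

lemma nerve_edge:
  assumes F: "F \<in> functors (ordinal n) C" and "i \<le> n" "j \<le> n"
  shows "nerve_edge C F i j \<in> Arr C"
    "Dom C (nerve_edge C F i j) = fst F i" "Cod C (nerve_edge C F i j) = fst F j"
    "inv_arr C (nerve_edge C F i j) = nerve_edge C F j i"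
  using assms functors_order(1-5)[OF F[unfolded ordinal_def]]
  by (auto simp: nerve_edge_def inv_arr inv_arr_Id dest: order_antisym)

lemma nerve_edge_refl:
  "\<lbrakk>F \<in> functors (ordinal n) C; i \<le> n\<rbrakk> \<Longrightarrow> nerve_edge C F i i = Id C (fst F i)"
  unfolding ordinal_def by (simp add: nerve_edge_def functors_order(5))

lemma nerve_edge_0:
  assumes F: "F \<in> functors (ordinal n) C" and "i \<le> n" "j \<le> n"
  shows "nerve_edge C F i j = Comp C (nerve_edge C F 0 j) (nerve_edge C F i 0)"
proof -
  have le: "nerve_edge C F k l = Comp C (nerve_edge C F 0 l) (nerve_edge C F k 0)"
    if kl: "k \<le> l" "l \<le> n" for k l
  proof -
    have "nerve_edge C F 0 l = Comp C (nerve_edge C F k l) (nerve_edge C F 0 k)"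
      using functors_order(6)[OF F[unfolded ordinal_def], of 0 k l] kl by (simp add: nerve_edge_def)
    then have "Comp C (nerve_edge C F 0 l) (nerve_edge C F k 0) =
        Comp C (nerve_edge C F k l) (Comp C (nerve_edge C F 0 k) (nerve_edge C F k 0))"
      using nerve_edge[OF F] kl by (simp add: Comp_assoc)
    also have "Comp C (nerve_edge C F 0 k) (nerve_edge C F k 0) = Id C (fst F k)"
      using inv_arr(5)[of "nerve_edge C F 0 k"] nerve_edge[OF F] kl by simp
    also have "Comp C (nerve_edge C F k l) \<dots> = nerve_edge C F k l"
      using Comp_Id_right[of "nerve_edge C F k l"] nerve_edge[OF F] kl by simp
    finally show ?thesis ..
  qed
  show ?thesis
  proof (cases "i \<le> j")
    case True
    then show ?thesis using assms(3) by (rule le)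
  next
    case False
    then have "nerve_edge C F i j = inv_arr C (nerve_edge C F j i)"
      using nerve_edge[OF F] assms by simp
    also have "\<dots> = inv_arr C (Comp C (nerve_edge C F 0 i) (nerve_edge C F j 0))"
      using le[of j i] False assms(2) by (intro arg_cong[where f = "inv_arr C"]) simp
    also have "\<dots> = Comp C (nerve_edge C F 0 j) (nerve_edge C F i 0)"
      using nerve_edge[OF F] assms by (simp add: inv_arr_Comp)
    finally show ?thesis .
  qed
qed

lemma nerve_edge_Comp:
  assumes F: "F \<in> functors (ordinal n) C" and "i \<le> n" "j \<le> n" "k \<le> n"
  shows "Comp C (nerve_edge C F j k) (nerve_edge C F i j) = nerve_edge C F i k"
proof -
  let ?e = "nerve_edge C F"
  note e = nerve_edge[OF F]
  have "Comp C (?e j k) (?e i j) = Comp C (Comp C (?e 0 k) (?e j 0)) (Comp C (?e 0 j) (?e i 0))"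
    using nerve_edge_0[OF F, of j k] nerve_edge_0[OF F, of i j] assms(2-4) by (intro arg_cong2[where f = "Comp C"])
  also have "\<dots> = Comp C (?e 0 k) (Comp C (?e j 0) (Comp C (?e 0 j) (?e i 0)))"
    using e assms by (simp add: Comp_assoc Comp_closed Dom_Comp Cod_Comp)
  also have "Comp C (?e j 0) (Comp C (?e 0 j) (?e i 0)) = Comp C (Comp C (?e j 0) (?e 0 j)) (?e i 0)"
    using e assms by (simp add: Comp_assoc)
  also have "Comp C (?e j 0) (?e 0 j) = Id C (fst F 0)"
    using inv_arr(4)[of "?e 0 j"] e assms by simp
  also have "Comp C (Id C (fst F 0)) (?e i 0) = ?e i 0"
    using Comp_Id_left[of "?e i 0"] e assms by simp
  also have "Comp C (?e 0 k) (?e i 0) = ?e i k"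
    using nerve_edge_0[OF F assms(2,4)] ..
  finally show ?thesis .
qed

lemma nerve_edge_act:
  assumes F: "F \<in> functors (ordinal n) C" and f: "f \<in> {..m} \<rightarrow> {..n}" and "i \<le> m" "j \<le> m"
  shows "nerve_edge C (act (nerve C) m n f F) i j = nerve_edge C F (f i) (f j)"
proof -
  have n: "f i \<le> n" "f j \<le> n" using assms(2-4) by auto
  have "snd (act (nerve C) m n f F) (k, l) = nerve_edge C F (f k) (f l)" if "k \<le> l" "l \<le> m" for k l
    using that by (simp add: nerve_def ordinal_def order_category_def)
  then show ?thesis
    unfolding nerve_edge_def[of C "act (nerve C) m n f F"]
    using assms(3,4) nerve_edge(4)[OF F n(2,1)] by (cases "i \<le> j") simp_all
qed

text \<open>The given action restricts to precomposition for monotone maps, and it turns the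
  nerve into a symmetric simplicial set.\<close>

lemma nerve_act_monotone:
  assumes "F \<in> functors (ordinal n) C" "mono_on {..m} f"
  shows "act (nerve C) m n f F =
    (\<lambda>i\<in>Obj (ordinal m). fst F (f i), \<lambda>(i, j)\<in>Arr (ordinal m). snd F (f i, f j))"
  using assms
  by (auto simp: nerve_def nerve_edge_def ordinal_def order_category_def fun_eq_iff restrict_def
      dest: mono_onD)

lemma symmetric_sset_nerve: "symmetric_sset (nerve C)"
proof
  fix f :: "nat \<Rightarrow> nat" and m n F
  assume f: "f \<in> {..m} \<rightarrow>\<^sub>E {..n}" and "F \<in> simp (nerve C) n"
  then have F: "F \<in> functors (ordinal n) C" by (simp add: nerve_def)
  have fn: "f i \<le> n" if "i \<le> m" for i using f that by auto
  have "fst F i \<in> Obj C" if "i \<le> n" for i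
    using functors_order(1)[OF F[unfolded ordinal_def]] that by simp
  then have "(\<lambda>i\<in>{..m}. fst F (f i),
      \<lambda>(i, j)\<in>{(i, j). i \<in> {..m} \<and> j \<in> {..m} \<and> i \<le> j}. nerve_edge C F (f i) (f j))
      \<in> functors (order_category {..m} (\<le>)) C"
    by (intro functors_orderI)
      (auto simp: fn nerve_edge(1-3)[OF F] nerve_edge_refl[OF F] nerve_edge_Comp[OF F])
  then show "act (nerve C) m n f F \<in> simp (nerve C) m"
    by (simp add: nerve_def ordinal_def order_category_def)
next
  fix n F assume "F \<in> simp (nerve C) n"
  then have F: "F \<in> functors (ordinal n) C" by (simp add: nerve_def)
  obtain Fo Fa where FF: "F = (Fo, Fa)" by (cases F)
  have "Fo \<in> extensional (Obj (ordinal n))" "Fa \<in> extensional (Arr (ordinal n))"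
    using functorsD(1,2)[OF F] by (simp_all add: FF)
  then show "act (nerve C) n n (\<lambda>i\<in>{..n}. i) F = F"
    by (auto simp: FF nerve_def nerve_edge_def ordinal_def order_category_def fun_eq_iff
        restrict_def extensional_def)
next
  fix f g :: "nat \<Rightarrow> nat" and l m n F
  assume f: "f \<in> {..l} \<rightarrow>\<^sub>E {..m}" and g: "g \<in> {..m} \<rightarrow>\<^sub>E {..n}" and "F \<in> simp (nerve C) n"
  then have F: "F \<in> functors (ordinal n) C" by (simp add: nerve_def)
  have e: "nerve_edge C (act (nerve C) m n g F) (f i) (f j) = nerve_edge C F (g (f i)) (g (f j))"
    if "i \<le> l" "j \<le> l" for i j
    by (rule nerve_edge_act[OF F]) (use f g that in auto)
  have v: "fst (act (nerve C) m n g F) (f i) = fst F (g (f i))" if "i \<le> l" for i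
    using f that by (auto simp: nerve_def ordinal_def order_category_def)
  have act: "act (nerve C) l k h G = (\<lambda>i\<in>{..l}. fst G (h i),
      \<lambda>(i, j)\<in>Arr (ordinal l). nerve_edge C G (h i) (h j))" for k h G
    by (simp add: nerve_def ordinal_def order_category_def)
  show "act (nerve C) l n (compose {..l} g f) F = act (nerve C) l m f (act (nerve C) m n g F)"
    unfolding act[of n] act[of m]
    by (auto simp: e v fun_eq_iff restrict_def compose_def ordinal_def order_category_def)
qed

end

section \<open>The symmetric simplicial set of functors on non-empty subsets\<close>

definition subset_poset :: "nat \<Rightarrow> (nat set, nat set \<times> nat set) precategory" where
  "subset_poset n = order_category {A. A \<noteq> {} \<and> A \<subseteq> {..n}} (\<subseteq>)"

definition tilde_sset ::
    "('o, 'a) precategory \<Rightarrow> ((nat set \<Rightarrow> 'o) \<times> (nat set \<times> nat set \<Rightarrow> 'a)) sset" where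
  "tilde_sset C = \<lparr>simp = (\<lambda>n. functors (subset_poset n) C),
     act = (\<lambda>m n f F. (\<lambda>A\<in>Obj (subset_poset m). fst F (f ` A),
                       \<lambda>(A, B)\<in>Arr (subset_poset m). snd F (f ` A, f ` B)))\<rparr>"

lemma symmetric_sset_tilde: "symmetric_sset (tilde_sset C)"
proof
  fix f :: "nat \<Rightarrow> nat" and m n F
  assume f: "f \<in> {..m} \<rightarrow>\<^sub>E {..n}" and "F \<in> simp (tilde_sset C) n"
  then have F: "F \<in> functors (order_category {A. A \<noteq> {} \<and> A \<subseteq> {..n}} (\<subseteq>)) C"
    by (simp add: tilde_sset_def subset_poset_def)
  have img: "f ` A \<noteq> {} \<and> f ` A \<subseteq> {..n}" if "A \<noteq> {} \<and> A \<subseteq> {..m}" for A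
    using f that by auto
  let ?S = "{A. A \<noteq> {} \<and> A \<subseteq> {..m}}"
  have "(\<lambda>A\<in>?S. fst F (f ` A),
      \<lambda>(A, B)\<in>{(A, B). A \<in> ?S \<and> B \<in> ?S \<and> A \<subseteq> B}. snd F (f ` A, f ` B))
      \<in> functors (order_category ?S (\<subseteq>)) C"
  proof (rule functors_orderI, goal_cases)
    case (3 A)
    then show ?case using functors_order(1,5)[OF F, of "f ` A"] img by simp
  next
    case (4 A B)
    then show ?case
      using functors_order(2-4)[OF F, of "f ` A" "f ` B"] img image_mono[of A B f] by simp
  next
    case (5 A B D)
    then show ?case
      using functors_order(6)[OF F, of "f ` A" "f ` B" "f ` D"] img
        image_mono[of A B f] image_mono[of B D f] by auto
  qed simp_all
  then show "act (tilde_sset C) m n f F \<in> simp (tilde_sset C) m"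
    by (simp add: tilde_sset_def subset_poset_def order_category_def)
next
  fix n F assume "F \<in> simp (tilde_sset C) n"
  then have F: "F \<in> functors (subset_poset n) C" by (simp add: tilde_sset_def)
  obtain Fo Fa where FF: "F = (Fo, Fa)" by (cases F)
  have "Fo \<in> extensional (Obj (subset_poset n))" "Fa \<in> extensional (Arr (subset_poset n))"
    using functorsD(1,2)[OF F] by (simp_all add: FF)
  moreover have "(\<lambda>i\<in>{..n}. i) ` A = A" if "A \<subseteq> {..n}" for A
    using that by (force simp: restrict_def image_def)
  ultimately show "act (tilde_sset C) n n (\<lambda>i\<in>{..n}. i) F = F"
    by (auto simp: FF tilde_sset_def subset_poset_def order_category_def fun_eq_iff
        restrict_def[of _ "Collect _"] extensional_def)
next
  fix f g :: "nat \<Rightarrow> nat" and l m n F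
  assume f: "f \<in> {..l} \<rightarrow>\<^sub>E {..m}" and "g \<in> {..m} \<rightarrow>\<^sub>E {..n}" "F \<in> simp (tilde_sset C) n"
  have "compose {..l} g f ` A = g ` f ` A" if "A \<subseteq> {..l}" for A
    using that by (force simp: compose_def image_def)
  moreover have "f ` A \<subseteq> {..m}" if "A \<subseteq> {..l}" for A
    using f that by auto
  ultimately show "act (tilde_sset C) l n (compose {..l} g f) F =
      act (tilde_sset C) l m f (act (tilde_sset C) m n g F)"
    by (auto simp: tilde_sset_def subset_poset_def order_category_def fun_eq_iff
        restrict_def image_mono simp del: image_subset_iff)
qed

end

theory Submission
  imports Defs
begin

text \<open>Both homotopy groupoids are isomorphic to the groupoid \<open>D\<close> of fractions. Suppose that the
  \<open>1\<close>-simplices of a symmetric simplicial set \<open>X\<close> are labelled by arrows of \<open>D\<close>, compatibly with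
  the vertices and with the \<open>2\<close>-simplices, and that the vertices of \<open>X\<close> correspond to the objects
  of \<open>D\<close>. The labels of a path compose to its holonomy, which is a homotopy invariant. If,
  conversely, every arrow of \<open>D\<close> is the holonomy of a chosen path, and these paths respect
  composition and retrieve the \<open>1\<close>-simplices up to homotopy, then the holonomy is an isomorphism.

  For the nerve of \<open>D\<close> the \<open>1\<close>-simplices are the arrows of \<open>D\<close> themselves. For functors on
  non-empty subsets, a pair \<open>(b\<^sub>0, b\<^sub>1)\<close> of arrows with a common target is labelled by the fraction
  \<open>b\<^sub>1\<^sup>-\<^sup>1 b\<^sub>0\<close>, and a letter \<open>f\<close> or \<open>f\<^sup>-\<^sup>1\<close> of a string gives the pair \<open>(f, 1)\<close> or \<open>(1, f)\<close>. A
  composable pair in \<open>C\<close> becomes a \<open>2\<close>-simplex by evaluation at the maximum of a subset, and a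
  \<open>2\<close>-simplex in which all larger subsets go to the common target of \<open>b\<^sub>0\<close> and \<open>b\<^sub>1\<close> shows that
  \<open>(b\<^sub>0, b\<^sub>1)\<close> is homotopic to \<open>(b\<^sub>0, 1)\<close> followed by \<open>(1, b\<^sub>1)\<close>.\<close>

section \<open>Functors and isomorphisms of groupoids\<close>

lemma functorsI:
  assumes "Fo \<in> extensional (Obj A)" "Fa \<in> extensional (Arr A)"
    and "\<And>x. x \<in> Obj A \<Longrightarrow> Fo x \<in> Obj B"
    and "\<And>f. f \<in> Arr A \<Longrightarrow> Fa f \<in> Arr B"
    and "\<And>f. f \<in> Arr A \<Longrightarrow> Dom B (Fa f) = Fo (Dom A f)"
    and "\<And>f. f \<in> Arr A \<Longrightarrow> Cod B (Fa f) = Fo (Cod A f)"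
    and "\<And>x. x \<in> Obj A \<Longrightarrow> Fa (Id A x) = Id B (Fo x)"
    and "\<And>f g. \<lbrakk>f \<in> Arr A; g \<in> Arr A; Dom A g = Cod A f\<rbrakk>
      \<Longrightarrow> Fa (Comp A g f) = Comp B (Fa g) (Fa f)"
  shows "(Fo, Fa) \<in> functors A B"
  using assms by (auto simp: functors_def PiE_def)

text \<open>The isomorphism is the inverse of \<open>G\<close> after \<open>F\<close>, restricted to
  be extensional. Each functor equation in \<open>B\<close> is checked after applying
  \<open>Go\<close> or \<open>Ga\<close>, which are injective: there both sides reduce to an
  equation for \<open>F\<close>.\<close>

lemma isomorphic_groupoids_common:
  assumes "isomorphic_groupoids A D" "isomorphic_groupoids B D"
  shows "isomorphic_groupoids A B"
proof -
  interpret A: groupoid A using assms by (simp add: isomorphic_groupoids_def)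
  interpret B: groupoid B using assms by (simp add: isomorphic_groupoids_def)
  obtain Fo Fa where F: "(Fo, Fa) \<in> functors A D"
    and Fb: "bij_betw Fo (Obj A) (Obj D)" "bij_betw Fa (Arr A) (Arr D)"
    using assms(1) by (auto simp: isomorphic_groupoids_def)
  obtain Go Ga where G: "(Go, Ga) \<in> functors B D"
    and Gb: "bij_betw Go (Obj B) (Obj D)" "bij_betw Ga (Arr B) (Arr D)"
    using assms(2) by (auto simp: isomorphic_groupoids_def)
  note F' = functorsD(3-8)[OF F, simplified] and G' = functorsD(3-8)[OF G, simplified]
  define Ho where "Ho = restrict (inv_into (Obj B) Go \<circ> Fo) (Obj A)"
  define Ha where "Ha = restrict (inv_into (Arr B) Ga \<circ> Fa) (Arr A)"
  have Ho_bij: "bij_betw Ho (Obj A) (Obj B)"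
    using bij_betw_trans[OF Fb(1) bij_betw_inv_into[OF Gb(1)]] by (simp add: Ho_def cong: bij_betw_cong)
  have Ha_bij: "bij_betw Ha (Arr A) (Arr B)"
    using bij_betw_trans[OF Fb(2) bij_betw_inv_into[OF Gb(2)]] by (simp add: Ha_def cong: bij_betw_cong)
  have Ho: "Ho x \<in> Obj B" "Go (Ho x) = Fo x" if "x \<in> Obj A" for x
    using that Ho_bij bij_betw_inv_into_right[OF Gb(1)] F'(1)
    by (auto simp: bij_betw_def) (simp add: Ho_def)
  have Ha: "Ha f \<in> Arr B" "Ga (Ha f) = Fa f" if "f \<in> Arr A" for f
    using that Ha_bij bij_betw_inv_into_right[OF Gb(2)] F'(2)
    by (auto simp: bij_betw_def) (simp add: Ha_def)
  have Go_inj: "x = y" if "Go x = Go y" "x \<in> Obj B" "y \<in> Obj B" for x y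
    using Gb(1) that by (auto simp: bij_betw_def dest: inj_onD)
  have Ga_inj: "x = y" if "Ga x = Ga y" "x \<in> Arr B" "y \<in> Arr B" for x y
    using Gb(2) that by (auto simp: bij_betw_def dest: inj_onD)
  have dom: "Dom B (Ha f) = Ho (Dom A f)" and cod: "Cod B (Ha f) = Ho (Cod A f)"
    if f: "f \<in> Arr A" for f
    using G'(3,4)[of "Ha f"] F'(3,4)[OF f]
    by (auto intro!: Go_inj simp: Ha[OF f] Ho A.Dom_closed A.Cod_closed f B.Dom_closed B.Cod_closed)
  have "(Ho, Ha) \<in> functors A B"
  proof (rule functorsI, goal_cases)
    case 1 show ?case by (simp add: Ho_def)
  next
    case 2 show ?case by (simp add: Ha_def)
  next
    case (7 x)
    then show ?case
      by (intro Ga_inj) (simp_all add: Ha Ho A.Id_closed B.Id_closed F' G')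
  next
    case (8 f g)
    then show ?case
      by (intro Ga_inj) (simp_all add: Ha Ho A.Comp_closed B.Comp_closed F' G' dom cod)
  qed (simp_all add: Ho Ha dom cod)
  then show ?thesis
    using Ho_bij Ha_bij A.groupoid_axioms B.groupoid_axioms
    by (auto simp: isomorphic_groupoids_def)
qed

text \<open>One factor is cancelled by the inverse. This is how labels of degenerate simplices are
  recognized as units.\<close>

lemma (in groupoid) idempotent_Id:
  assumes "f \<in> Arr C" "Dom C f = Cod C f" "Comp C f f = f"
  shows "f = Id C (Dom C f)"
proof -
  have "Id C (Dom C f) = Comp C (inv_arr C f) (Comp C f f)"
    using assms by (simp add: inv_arr)
  also have "\<dots> = Comp C (Comp C (inv_arr C f) f) f"
    using assms by (intro Comp_assoc) (simp_all add: inv_arr)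
  also have "\<dots> = f"
    using assms Comp_Id_left[of f] by (simp add: inv_arr)
  finally show ?thesis ..
qed

section \<open>Further homotopies in a symmetric simplicial set\<close>

context symmetric_sset
begin

text \<open>Paths are non-empty, but the rest of a string after a replaced segment may be empty;
  this version of \<open>homotopy_append_right\<close> covers that case too.\<close>

lemma homotopy_extend_right:
  assumes "(p, q) \<in> homotopy X" "p @ a \<in> paths X"
  shows "(p @ a, q @ a) \<in> homotopy X"
  using assms homotopy_append_right[OF assms(1), of a] homotopy_paths path_nonempty paths_append[of p a]
  by (cases "a = []") auto

lemma homotopy_extend_left:
  assumes "(p, q) \<in> homotopy X" "a @ p \<in> paths X"
  shows "(a @ p, a @ q) \<in> homotopy X"
  using assms homotopy_append_left[OF assms(1), of a] homotopy_paths path_nonempty paths_append[of a p]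
  by (cases "a = []") auto

text \<open>The backtracking pair is homotopic to a degenerate simplex, which the path
  \<open>p\<close> absorbs. Without \<open>p\<close> the result of the cancellation would be the
  empty list, which is not a path.\<close>

lemma homotopy_cancel_right:
  assumes "p \<in> paths X" "b \<in> simp X 1" "path_target X p = face X 1 1 b"
  shows "(p @ [b, swap X 1 0 b], p) \<in> homotopy X"
proof -
  have "[b, swap X 1 0 b] \<in> paths X"
    using homotopy_inverse_1[OF assms(2)] homotopy_paths by blast
  then have "p @ [b, swap X 1 0 b] \<in> paths X"
    using assms path_nonempty by (simp add: paths_append path_source_def)
  then show ?thesis
    using homotopy_extend_left[OF homotopy_inverse_1[OF assms(2)]] homotopy_unit_right[OF assms(1)]
      assms(3) homotopy_trans by metis
qed

lemma homotopy_triangle_swap: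
  assumes "c \<in> simp X 2"
  shows "([swap X 1 0 (face X 2 1 c)],
      [swap X 1 0 (face X 2 0 c), swap X 1 0 (face X 2 2 c)]) \<in> homotopy X"
proof -
  \<comment> \<open>The triangle with its vertices in reverse order: its edges are the reversed
    edges of \<open>c\<close>, with faces 0 and 2 exchanged.\<close>
  let ?c = "act X 2 2 (\<lambda>j\<in>{..2}. 2 - j) c"
  note [simp del] = One_nat_def
  have c: "?c \<in> simp X 2" using assms by (intro act_in) auto
  have "face X 2 1 ?c = swap X 1 0 (face X 2 1 c)" "face X 2 2 ?c = swap X 1 0 (face X 2 0 c)"
    "face X 2 0 ?c = swap X 1 0 (face X 2 2 c)"
    using assms by (auto simp: face_2 swap_def act_act intro!: act_cong)
  then show ?thesis using homotopy_triangle[OF c] by simp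
qed

end

section \<open>Holonomy of groupoid-valued labellings\<close>

text \<open>A nonabelian 1-cocycle: labels are multiplicative on triangles. Bijectivity of
  \<open>vert\<close> makes the holonomy functor bijective on objects, and it allows equality of
  0-simplices to be tested on objects of \<open>D\<close>. That degenerate simplices carry units is
  derived in \<open>edge_degen\<close>.\<close>

locale groupoid_cocycle = X: symmetric_sset X + D: groupoid D
  for X :: "'s sset" and D :: "('o, 'a) precategory" +
  fixes vert :: "'s \<Rightarrow> 'o" and edge :: "'s \<Rightarrow> 'a"
  assumes vert_bij: "bij_betw vert (simp X 0) (Obj D)"
    and edge_Arr: "b \<in> simp X 1 \<Longrightarrow> edge b \<in> Arr D"
    and Dom_edge: "b \<in> simp X 1 \<Longrightarrow> Dom D (edge b) = vert (face X 1 1 b)"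
    and Cod_edge: "b \<in> simp X 1 \<Longrightarrow> Cod D (edge b) = vert (face X 1 0 b)"
    and edge_triangle: "c \<in> simp X 2 \<Longrightarrow>
      edge (face X 2 1 c) = Comp D (edge (face X 2 0 c)) (edge (face X 2 2 c))"
begin

text \<open>The starting arrow \<open>a\<close> is arbitrary so that inductions on the path go
  through. Labels are composed on the left because a path lists its simplices in the order of
  traversal.\<close>

definition run :: "'a \<Rightarrow> 's list \<Rightarrow> 'a" where
  "run = foldl (\<lambda>a b. Comp D (edge b) a)"

definition holonomy :: "'s list \<Rightarrow> 'a" where
  "holonomy p = run (Id D (vert (path_source X p))) p"

lemma run_simps: "run a [] = a" "run a (b # p) = run (Comp D (edge b) a) p"
  "run a (p @ q) = run (run a p) q"
  by (simp_all add: run_def)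

lemma vert_Obj: "x \<in> simp X 0 \<Longrightarrow> vert x \<in> Obj D"
  using vert_bij by (auto simp: bij_betw_def)

lemma vert_inj: "\<lbrakk>vert x = vert y; x \<in> simp X 0; y \<in> simp X 0\<rbrakk> \<Longrightarrow> x = y"
  using vert_bij by (auto simp: bij_betw_def dest: inj_onD)

lemma paths_Cons: "p \<noteq> [] \<Longrightarrow>
  b # p \<in> paths X \<longleftrightarrow> b \<in> simp X 1 \<and> p \<in> paths X \<and> face X 1 0 b = path_source X p"
  using X.paths_append[of "[b]" p] by (simp add: X.path_singleton)

lemma run_Arr:
  assumes "p \<in> paths X" "a \<in> Arr D" "Cod D a = vert (path_source X p)"
  shows "run a p \<in> Arr D \<and> Dom D (run a p) = Dom D a \<and> Cod D (run a p) = vert (path_target X p)"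
  using assms
proof (induction p arbitrary: a)
  case Nil
  then show ?case by (simp add: paths_def)
next
  case (Cons b p)
  have b: "b \<in> simp X 1" using Cons.prems by (auto simp: paths_def)
  then have ba: "Comp D (edge b) a \<in> Arr D" "Dom D (Comp D (edge b) a) = Dom D a"
    "Cod D (Comp D (edge b) a) = vert (face X 1 0 b)"
    using Cons.prems edge_Arr Dom_edge Cod_edge
    by (simp_all add: path_source_def D.Comp_closed D.Dom_Comp D.Cod_Comp)
  then show ?case
  proof (cases "p = []")
    case True
    then show ?thesis using ba by (simp add: run_simps path_target_def)
  next
    case False
    then show ?thesis using ba Cons.IH[of "Comp D (edge b) a"] Cons.prems
      by (simp add: run_simps path_target_def paths_Cons)
  qed
qed

text \<open>A right factor of the starting arrow passes through by associativity at every simplex.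
  With a unit for \<open>a\<close> this turns a run continued from an earlier path into a composite
  of holonomies.\<close>

lemma run_Comp:
  assumes "p \<in> paths X" "a \<in> Arr D" "c \<in> Arr D" "Cod D a = vert (path_source X p)" "Dom D a = Cod D c"
  shows "run (Comp D a c) p = Comp D (run a p) c"
  using assms
proof (induction p arbitrary: a)
  case Nil
  then show ?case by (simp add: paths_def)
next
  case (Cons b p)
  have b: "b \<in> simp X 1" using Cons.prems by (auto simp: paths_def)
  then have *: "Comp D (edge b) (Comp D a c) = Comp D (Comp D (edge b) a) c"
    using Cons.prems edge_Arr Dom_edge by (intro D.Comp_assoc) (simp_all add: path_source_def)
  then show ?case
  proof (cases "p = []")
    case True
    then show ?thesis using * by (simp add: run_simps)
  next
    case False
    then show ?thesis
      using * Cons.IH[of "Comp D (edge b) a"] Cons.prems b edge_Arr Dom_edge Cod_edge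
      by (simp add: run_simps path_source_def paths_Cons D.Comp_closed D.Dom_Comp D.Cod_Comp)
  qed
qed

lemma holonomy_Arr:
  assumes "p \<in> paths X"
  shows "holonomy p \<in> Arr D" "Dom D (holonomy p) = vert (path_source X p)"
    "Cod D (holonomy p) = vert (path_target X p)"
  using run_Arr[OF assms, of "Id D (vert (path_source X p))"] X.path_ends_in[OF assms] vert_Obj
  by (simp_all add: holonomy_def D.Id_closed D.Dom_Id D.Cod_Id)

lemma holonomy_append:
  assumes "p \<in> paths X" "q \<in> paths X" "path_target X p = path_source X q"
  shows "holonomy (p @ q) = Comp D (holonomy q) (holonomy p)"
proof -
  have "vert (path_source X q) \<in> Obj D" using X.path_ends_in[OF assms(2)] vert_Obj by simp
  \<comment> \<open>The run along \<open>q\<close> starts at \<open>holonomy p\<close>; a unit is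
    written in front of it to match \<open>run_Comp\<close>.\<close>
  then have "run (Comp D (Id D (vert (path_source X q))) (holonomy p)) q =
      Comp D (holonomy q) (holonomy p)"
    unfolding holonomy_def[of q] using assms holonomy_Arr[OF assms(1)]
    by (intro run_Comp) (simp_all add: D.Id_closed D.Dom_Id D.Cod_Id)
  then show ?thesis
    using D.Comp_Id_left[of "holonomy p"] holonomy_Arr[OF assms(1)] assms(3) X.path_nonempty[OF assms(1)]
    by (simp add: holonomy_def run_simps X.path_ends_append)
qed

lemma holonomy_singleton: "b \<in> simp X 1 \<Longrightarrow> holonomy [b] = edge b"
  using D.Comp_Id_right[of "edge b"] edge_Arr[of b] Dom_edge[of b]
  by (simp add: holonomy_def run_simps path_source_def)

lemma holonomy_homotopy_step:
  assumes "homotopy_step X p q" shows "holonomy p = holonomy q"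
proof -
  obtain v w c where c: "c \<in> simp X 2" and p: "p = v @ [face X 2 1 c] @ w"
    and q: "q = v @ [face X 2 2 c, face X 2 0 c] @ w" and path: "p \<in> paths X"
    using assms by (auto simp: homotopy_step_def)
  note b = X.face_in_2[OF c] and fc = X.faces_2[OF c]
  \<comment> \<open>\<open>A\<close> is the composite of the labels before the triangle. The empty
    \<open>v\<close> is not a path, so in that case \<open>A\<close> is examined directly, as the
    unit at the source. Once the two runs agree after the triangle, they agree along
    \<open>w\<close>.\<close>
  define A where "A = run (Id D (vert (path_source X p))) v"
  have A: "A \<in> Arr D \<and> Cod D A = vert (face X 1 1 (face X 2 2 c))"
  proof (cases "v = []")
    case True
    then show ?thesis
      using vert_Obj X.path_ends_in(1)[OF path] fc
      by (simp add: A_def run_simps D.Id_closed D.Cod_Id p path_source_def)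
  next
    case False
    then have v: "v \<in> paths X" "path_target X v = face X 1 1 (face X 2 1 c)"
      using path X.paths_append[of v "[face X 2 1 c] @ w"] by (simp_all add: p path_source_def)
    have "A = holonomy v" using False by (simp add: A_def holonomy_def p X.path_ends_append)
    then show ?thesis using holonomy_Arr[OF v(1)] v(2) fc by simp
  qed
  have "Comp D (edge (face X 2 1 c)) A = Comp D (edge (face X 2 0 c)) (Comp D (edge (face X 2 2 c)) A)"
    unfolding edge_triangle[OF c] using A b fc
    by (intro D.Comp_assoc[symmetric]) (simp_all add: edge_Arr Dom_edge Cod_edge)
  then show ?thesis
    using X.homotopy_step_ends(1)[OF assms]
    by (simp add: A_def holonomy_def run_simps p q)
qed

lemma holonomy_homotopy: "(p, q) \<in> homotopy X \<Longrightarrow> holonomy p = holonomy q"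
  by (auto simp: homotopy_def intro: equivclp_invariant[OF _ holonomy_homotopy_step])

text \<open>A degenerate simplex followed by itself is homotopic to itself, so its label is
  idempotent, and idempotents of a groupoid are units.\<close>

lemma edge_degen:
  assumes x: "x \<in> simp X 0" shows "edge (degen X 0 0 x) = Id D (vert x)"
proof -
  let ?b = "degen X 0 0 x"
  have b: "?b \<in> simp X 1" using x by (rule X.degen_0_in)
  have h: "([?b, ?b], [?b]) \<in> homotopy X"
    using X.homotopy_unit_1(1)[OF b] by (simp add: X.ends_degen[OF x, unfolded One_nat_def])
  have "holonomy ([?b] @ [?b]) = Comp D (holonomy [?b]) (holonomy [?b])"
    using b by (intro holonomy_append) (simp_all add: X.path_singleton X.ends_degen[OF x, unfolded One_nat_def])
  then have "Comp D (edge ?b) (edge ?b) = edge ?b"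
    using holonomy_homotopy[OF h] holonomy_singleton[OF b] by simp
  then show ?thesis
    using D.idempotent_Id[of "edge ?b"] edge_Arr[OF b] Dom_edge[OF b] Cod_edge[OF b]
      X.ends_degen[OF x] by simp
qed

text \<open>By induction on \<open>p\<close>, splitting off its first simplex,
  \<open>g (holonomy p)\<close> is homotopic to \<open>p\<close>; hence paths with equal holonomy
  are homotopic, and the functor is injective on arrows. It is surjective because \<open>g\<close>
  is a section of the holonomy.\<close>

lemma isomorphic_homotopy_groupoid:
  assumes g_paths: "\<And>a. a \<in> Arr D \<Longrightarrow> g a \<in> paths X"
    and holonomy_g: "\<And>a. a \<in> Arr D \<Longrightarrow> holonomy (g a) = a"
    and g_Comp: "\<And>a b. \<lbrakk>a \<in> Arr D; b \<in> Arr D; Dom D b = Cod D a\<rbrakk> \<Longrightarrow>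
      (g a @ g b, g (Comp D b a)) \<in> homotopy X"
    and g_edge: "\<And>b. b \<in> simp X 1 \<Longrightarrow> (g (edge b), [b]) \<in> homotopy X"
  shows "isomorphic_groupoids (homotopy_groupoid X) D"
proof -
  interpret P: path_congruence "simp X 0" "paths X" "homotopy X"
    "path_source X" "path_target X" "\<lambda>x. [degen X 0 0 x]" "(@)"
    by (rule X.path_congruence_homotopy)
  let ?Q = "homotopy_groupoid X"
  note Q = homotopy_groupoid_def[of X]
  have g_holonomy: "(g (holonomy p), p) \<in> homotopy X" if "p \<in> paths X" for p
    using that
  proof (induction p)
    case Nil
    then show ?case by (simp add: paths_def)
  next
    case (Cons b p)
    have b: "b \<in> simp X 1" using Cons.prems by (auto simp: paths_def)
    show ?case
    proof (cases "p = []")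
      case True
      then show ?thesis using b g_edge holonomy_singleton by simp
    next
      case False
      then have p: "p \<in> paths X" "face X 1 0 b = path_source X p"
        using Cons.prems by (simp_all add: paths_Cons)
      have b': "[b] \<in> paths X" "path_target X [b] = path_source X p"
        using b p by (simp_all add: X.path_singleton)
      have ends: "Dom D (holonomy p) = Cod D (edge b)"
        using p b Cod_edge holonomy_Arr by simp
      have hb: "holonomy (b # p) = Comp D (holonomy p) (edge b)"
        using holonomy_append[OF b'(1) p(1) b'(2)] b holonomy_singleton by simp
      have IH: "(g (holonomy p), p) \<in> homotopy X" using Cons.IH p(1) .
      have 1: "(g (edge b) @ g (holonomy p), [b] @ p) \<in> homotopy X"
        using b' X.homotopy_ends[OF IH] X.homotopy_ends[OF g_edge[OF b]]
        by (intro X.homotopy_append g_edge[OF b] IH) simp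
      have 2: "(g (edge b) @ g (holonomy p), g (holonomy (b # p))) \<in> homotopy X"
        unfolding hb using b p edge_Arr holonomy_Arr ends by (intro g_Comp) simp_all
      show ?thesis using X.homotopy_trans[OF X.homotopy_sym[OF 2] 1] by simp
    qed
  qed
  define Fo where "Fo = restrict vert (simp X 0)"
  \<comment> \<open>The value at a class is read off a chosen representative; homotopy invariance
    makes the choice immaterial.\<close>
  define Fa where "Fa = (\<lambda>P\<in>Arr ?Q. holonomy (SOME p. p \<in> P))"
  have Fa: "Fa (homotopy X `` {p}) = holonomy p" if "p \<in> paths X" for p
    using holonomy_homotopy[OF P.some_in_class[OF that]] P.class_in_Arr[OF that]
    by (simp add: Fa_def Q)
  have Arr: "\<exists>p\<in>paths X. f = homotopy X `` {p}" if "f \<in> Arr ?Q" for f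
    using that by (auto simp: Q P.Arr_Q elim: quotientE)
  have "(Fo, Fa) \<in> functors ?Q D"
  proof (rule functorsI, goal_cases)
    case 1 show ?case by (simp add: Fo_def Q P.Obj_Q)
  next
    case 2 show ?case by (simp add: Fa_def)
  next
    case (3 x) then show ?case using vert_Obj by (simp add: Fo_def Q P.Obj_Q)
  next
    case (4 f) then show ?case using Arr Fa holonomy_Arr by metis
  next
    case (5 f)
    then obtain p where "p \<in> paths X" "f = homotopy X `` {p}" using Arr by blast
    then show ?case using holonomy_Arr P.Dom_class P.s_Ob by (simp add: Fa Fo_def Q)
  next
    case (6 f)
    then obtain p where "p \<in> paths X" "f = homotopy X `` {p}" using Arr by blast
    then show ?case using holonomy_Arr P.Cod_class P.t_Ob by (simp add: Fa Fo_def Q)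
  next
    case (7 x)
    then have x: "x \<in> simp X 0" by (simp add: Q P.Obj_Q)
    then show ?case
      using Fa[OF P.u_S[OF x]] holonomy_singleton[OF X.degen_0_in] edge_degen
      by (simp add: Q P.Id_Q Fo_def)
  next
    case (8 f f')
    obtain p where p: "p \<in> paths X" "f = homotopy X `` {p}" using Arr 8 by blast
    obtain q where q: "q \<in> paths X" "f' = homotopy X `` {q}" using Arr 8 by blast
    have pq: "path_target X p = path_source X q"
      using 8 p q P.Dom_class P.Cod_class by (simp add: Q)
    then show ?case
      using p q P.Comp_class[OF p(1) q(1) pq] P.k_S[OF p(1) q(1) pq] holonomy_append
      by (simp add: Fa Q)
  qed
  moreover have "bij_betw Fo (simp X 0) (Obj D)"
    using vert_bij by (simp add: Fo_def cong: bij_betw_cong)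
  then have "bij_betw Fo (Obj ?Q) (Obj D)" by (simp add: Q P.Obj_Q)
  moreover have "bij_betw Fa (Arr ?Q) (Arr D)"
    unfolding bij_betw_def
  proof
    show "inj_on Fa (Arr ?Q)"
    proof (rule inj_onI)
      fix f f' assume "f \<in> Arr ?Q" "f' \<in> Arr ?Q" and eq: "Fa f = Fa f'"
      then obtain p q where p: "p \<in> paths X" "f = homotopy X `` {p}"
        and q: "q \<in> paths X" "f' = homotopy X `` {q}" using Arr by metis
      have "holonomy p = holonomy q" using eq p q Fa by simp
      then have "(p, q) \<in> homotopy X"
        using g_holonomy[OF p(1)] g_holonomy[OF q(1)] X.homotopy_sym X.homotopy_trans by metis
      then show "f = f'" using p q P.class_eq by simp
    qed
    show "Fa ` Arr ?Q = Arr D"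
    proof safe
      fix f assume "f \<in> Arr ?Q"
      then show "Fa f \<in> Arr D" using Arr Fa holonomy_Arr by metis
    next
      fix a assume "a \<in> Arr D"
      then show "a \<in> Fa ` Arr ?Q"
        using Fa g_paths holonomy_g P.class_in_Arr by (metis Q image_eqI)
    qed
  qed
  ultimately show ?thesis
    using X.groupoid_homotopy_groupoid D.groupoid_axioms by (auto simp: isomorphic_groupoids_def)
qed

end

section \<open>The nerve\<close>

lemma functors_order_eqI:
  assumes F: "F \<in> functors (order_category S le) B" and G: "G \<in> functors (order_category S le) B"
    and obj: "\<And>x. x \<in> S \<Longrightarrow> fst F x = fst G x"
    and arr: "\<And>x y. \<lbrakk>x \<in> S; y \<in> S; le x y; x \<noteq> y\<rbrakk> \<Longrightarrow> snd F (x, y) = snd G (x, y)"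
  shows "F = G"
proof (rule prod_eqI)
  show "fst F = fst G"
    using functorsD(1)[OF F] functorsD(1)[OF G] obj
    by (intro extensionalityI) (auto simp: order_category_def)
  have "snd F (x, y) = snd G (x, y)" if "x \<in> S" "y \<in> S" "le x y" for x y
    using that obj arr functors_order(5)[OF F] functors_order(5)[OF G] by (cases "x = y") auto
  then show "snd F = snd G"
    using functorsD(2)[OF F] functorsD(2)[OF G]
    by (intro extensionalityI) (auto simp: order_category_def)
qed

text \<open>Serves to realize every object as a 0-simplex, both in the nerve and for functors on
  subsets.\<close>

lemma (in category) constant_functor:
  assumes "x \<in> Obj C" "reflp le" "transp le"
  shows "(\<lambda>i\<in>S. x, \<lambda>(i, j)\<in>{(i, j). i \<in> S \<and> j \<in> S \<and> le i j}. Id C x)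
    \<in> functors (order_category S le) C"
  using assms Comp_Id_left[of "Id C x"]
  by (intro functors_orderI) (auto simp: Id_closed Dom_Id Cod_Id dest: reflpD transpD)

text \<open>The 2-simplex of the nerve with successive arrows \<open>f\<close> and \<open>g\<close>.
  Once \<open>i = j\<close> is excluded, \<open>i = 1\<close> forces the pair \<open>(1, 2)\<close>
  and \<open>j = 1\<close> forces \<open>(0, 1)\<close>, so the last case is
  \<open>(0, 2)\<close>.\<close>

definition chain :: "('o, 'a) precategory \<Rightarrow> 'a \<Rightarrow> 'a \<Rightarrow> (nat \<Rightarrow> 'o) \<times> (nat \<times> nat \<Rightarrow> 'a)" where
  "chain C f g =
    (let v = (\<lambda>i. if i = 0 then Dom C f else if i = 1 then Dom C g else Cod C g)
     in (restrict v {..2}, \<lambda>(i, j)\<in>{(i, j). i \<in> {..2} \<and> j \<in> {..2} \<and> i \<le> j}.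
       if i = j then Id C (v i) else if i = 1 then g else if j = 1 then f else Comp C g f))"

lemma (in category) chain:
  assumes "f \<in> Arr C" "g \<in> Arr C" "Dom C g = Cod C f"
  shows "chain C f g \<in> functors (ordinal 2) C"
  unfolding chain_def Let_def ordinal_def
proof (rule functors_orderI, goal_cases)
  case (3 x)
  then show ?case using assms by (auto simp: Dom_closed Cod_closed)
next
  case (4 x y)
  then show ?case using assms
    by (auto simp: Dom_closed Cod_closed Id_closed Dom_Id Cod_Id Comp_closed Dom_Comp Cod_Comp)
next
  case (5 x y z)
  have "Comp C (Comp C g f) (Id C (Dom C f)) = Comp C g f"
    "Comp C (Id C (Cod C g)) (Comp C g f) = Comp C g f"
    using assms Comp_Id_left[of "Comp C g f"] Comp_Id_right[of "Comp C g f"]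
    by (simp_all add: Comp_closed Dom_Comp Cod_Comp)
  moreover have "Comp C (Id C w) (Id C w) = Id C w" if "w \<in> Obj C" for w
    using that Comp_Id_left[of "Id C w"] by (simp add: Id_closed Cod_Id)
  moreover have "x \<in> {0, 1, 2}" "y \<in> {0, 1, 2}" "z \<in> {0, 1, 2}"
    using 5 by auto
  ultimately show ?case
    using assms 5(4,5) Comp_Id_left[of f] Comp_Id_right[of g] Comp_Id_right[of f] Comp_Id_left[of g]
    by (auto simp: Dom_closed Cod_closed)
qed simp_all

text \<open>The values at \<open>(1, 1)\<close> and \<open>(2, 2)\<close> enter when subsets are
  replaced by their maxima in \<open>chain_homotopy\<close>.\<close>

lemma chain_simps:
  "snd (chain C f g) (0, 1) = f" "snd (chain C f g) (1, 2) = g" "snd (chain C f g) (0, 2) = Comp C g f"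
  "snd (chain C f g) (1, 1) = Id C (Dom C g)" "snd (chain C f g) (2, 2) = Id C (Cod C g)"
  by (simp_all add: chain_def)

context groupoid
begin

context
  notes [simp del] = One_nat_def
begin

lemma nerve_1_eqI:
  assumes F: "F \<in> simp (nerve C) 1" and G: "G \<in> simp (nerve C) 1" and eq: "snd F (0, 1) = snd G (0, 1)"
  shows "F = G"
proof -
  have F': "F \<in> functors (order_category {..1} (\<le>)) C" and G': "G \<in> functors (order_category {..1} (\<le>)) C"
    using F G by (simp_all add: nerve_def ordinal_def)
  have le: "i = 0 \<or> i = 1" if "i \<le> 1" for i :: nat using that by auto
  have "fst F 0 = fst G 0" "fst F 1 = fst G 1"
    using functors_order(3,4)[OF F', of 0 1] functors_order(3,4)[OF G', of 0 1] eq by simp_all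
  then show ?thesis
    by (intro functors_order_eqI[OF F' G']) (auto dest!: le simp: eq)
qed

text \<open>Functors on a one-point order are objects, which gives the bijection on vertices, and
  the triangle condition is the composition law for the edges of a 2-simplex.\<close>

lemma groupoid_cocycle_nerve:
  "groupoid_cocycle (nerve C) C (\<lambda>F. fst F 0) (\<lambda>F. snd F (0, 1))"
proof (intro groupoid_cocycle.intro groupoid_cocycle_axioms.intro symmetric_sset_nerve groupoid_axioms)
  interpret N: symmetric_sset "nerve C" by (rule symmetric_sset_nerve)
  have F_iff: "F \<in> simp (nerve C) n \<longleftrightarrow> F \<in> functors (ordinal n) C" for F n
    by (simp add: nerve_def)
  show "bij_betw (\<lambda>F. fst F 0) (simp (nerve C) 0) (Obj C)"
    unfolding bij_betw_def
  proof
    show "inj_on (\<lambda>F. fst F 0) (simp (nerve C) 0)"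
    proof (rule inj_onI)
      fix F G assume "F \<in> simp (nerve C) 0" "G \<in> simp (nerve C) 0" "fst F 0 = fst G 0"
      then show "F = G"
        unfolding F_iff ordinal_def by (elim functors_order_eqI) auto
    qed
    show "(\<lambda>F. fst F 0) ` simp (nerve C) 0 = Obj C"
    proof
      show "(\<lambda>F. fst F 0) ` simp (nerve C) 0 \<subseteq> Obj C"
        by (auto simp: F_iff ordinal_def intro: functors_order(1))
      show "Obj C \<subseteq> (\<lambda>F. fst F 0) ` simp (nerve C) 0"
      proof
        fix x assume "x \<in> Obj C"
        then show "x \<in> (\<lambda>F. fst F 0) ` simp (nerve C) 0"
          using constant_functor[of x "(\<le>)" "{..0 :: nat}"]
          by (force simp: F_iff ordinal_def intro!: image_eqI)
      qed
    qed
  qed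
  fix b assume "b \<in> simp (nerve C) 1"
  then have b: "b \<in> functors (ordinal 1) C" by (simp add: F_iff)
  show "snd b (0, 1) \<in> Arr C" "Dom C (snd b (0, 1)) = fst (face (nerve C) 1 1 b) 0"
    "Cod C (snd b (0, 1)) = fst (face (nerve C) 1 0 b) 0"
    using functors_order(2-4)[OF b[unfolded ordinal_def], of 0 1]
    by (simp_all add: N.face_1) (simp_all add: nerve_def ordinal_def order_category_def One_nat_def)
next
  interpret N: symmetric_sset "nerve C" by (rule symmetric_sset_nerve)
  fix c assume "c \<in> simp (nerve C) 2"
  then have c: "c \<in> functors (ordinal 2) C" by (simp add: nerve_def)
  have "snd (face (nerve C) 2 i c) (0, 1) = 
      nerve_edge C c (if 0 < i then 0 else Suc 0) (if 1 < i then 1 else Suc 1)" for i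
    by (simp add: N.face_2) (simp add: nerve_def ordinal_def order_category_def)
  then show "snd (face (nerve C) 2 1 c) (0, 1) =
      Comp C (snd (face (nerve C) 2 0 c) (0, 1)) (snd (face (nerve C) 2 2 c) (0, 1))"
    using nerve_edge_Comp[OF c, of 0 1 2] by (simp add: One_nat_def numeral_2_eq_2)
qed

lemma isomorphic_homotopy_groupoid_nerve:
  "isomorphic_groupoids (homotopy_groupoid (nerve C)) C"
proof -
  interpret N: groupoid_cocycle "nerve C" C "\<lambda>F. fst F 0" "\<lambda>F. snd F (0, 1)"
    by (rule groupoid_cocycle_nerve)
  \<comment> \<open>The 1-simplex with arrow \<open>a\<close>, obtained as a face of a triangle
    whose second arrow is a unit.\<close>
  let ?s = "\<lambda>a. face (nerve C) 2 2 (chain C a (Id C (Cod C a)))"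
  have ch: "chain C a b \<in> simp (nerve C) 2" if "a \<in> Arr C" "b \<in> Arr C" "Dom C b = Cod C a" for a b
    using chain[OF that] by (simp add: nerve_def)
  have faces: "snd (face (nerve C) 2 2 (chain C a b)) (0, 1) = a"
    "snd (face (nerve C) 2 0 (chain C a b)) (0, 1) = b"
    "snd (face (nerve C) 2 1 (chain C a b)) (0, 1) = Comp C b a" for a b
    unfolding N.X.face_2
    by (simp_all add: nerve_def ordinal_def order_category_def nerve_edge_def
        chain_simps[unfolded One_nat_def numeral_2_eq_2] One_nat_def numeral_2_eq_2)
  have s: "?s a \<in> simp (nerve C) 1" "snd (?s a) (0, 1) = a" if "a \<in> Arr C" for a
    using that by (auto intro!: N.X.face_in_2 ch simp: Cod_closed Id_closed Dom_Id faces)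
  have s_eq: "?s (snd b (0, 1)) = b" if "b \<in> simp (nerve C) 1" for b
    using that N.edge_Arr s by (intro nerve_1_eqI) simp_all
  show ?thesis
  proof (rule N.isomorphic_homotopy_groupoid[where g = "\<lambda>a. [?s a]"])
    fix a assume "a \<in> Arr C"
    then show "[?s a] \<in> paths (nerve C)" "N.holonomy [?s a] = a"
      using s by (simp_all add: N.X.path_singleton N.holonomy_singleton)
  next
    fix a b assume ab: "a \<in> Arr C" "b \<in> Arr C" "Dom C b = Cod C a"
    note f = N.X.face_in_2[OF ch[OF ab]]
    \<comment> \<open>A 1-simplex is determined by its arrow, so the chosen simplices are the faces
      of \<open>chain C a b\<close>, and this triangle supplies the homotopy.\<close>
    have "?s a = face (nerve C) 2 2 (chain C a b)" "?s b = face (nerve C) 2 0 (chain C a b)"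
      "?s (Comp C b a) = face (nerve C) 2 1 (chain C a b)"
      using s_eq[OF f] by (metis faces)+
    then show "([?s a] @ [?s b], [?s (Comp C b a)]) \<in> homotopy (nerve C)"
      using N.X.homotopy_sym[OF N.X.homotopy_triangle[OF ch[OF ab]]] by simp
  next
    fix b assume "b \<in> simp (nerve C) 1"
    then show "([?s (snd b (0, 1))], [b]) \<in> homotopy (nerve C)"
      by (simp only: s_eq) (simp add: N.X.homotopy_refl N.X.path_singleton)
  qed
qed

end

end

section \<open>Classes of strings\<close>

definition frac_class ::
    "('o, 'a) precategory \<Rightarrow> 'o \<Rightarrow> 'a letter list \<Rightarrow> 'o \<Rightarrow> ('o \<times> 'a letter list \<times> 'o) set" where
  "frac_class C x w y = frac_equiv C `` {(x, w, y)}"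

context category
begin

interpretation F: path_congruence "Obj C" "strings C" "frac_equiv C"
  "\<lambda>(x, w, y). x" "\<lambda>(x, w, y). y" "\<lambda>x. (x, [], x)" "\<lambda>(x, v, y) (x', w, z). (x, v @ w, z)"
  by (rule path_congruence_fractions)

lemma frac_class:
  assumes "composable C x w y"
  shows "frac_class C x w y \<in> Arr (fractions C)" "Dom (fractions C) (frac_class C x w y) = x"
    "Cod (fractions C) (frac_class C x w y) = y"
proof -
  have p: "(x, w, y) \<in> strings C" using assms by (simp add: strings_def)
  show "frac_class C x w y \<in> Arr (fractions C)" "Dom (fractions C) (frac_class C x w y) = x"
    "Cod (fractions C) (frac_class C x w y) = y"
    using F.class_in_Arr[OF p] F.Dom_class[OF p] F.Cod_class[OF p]
    by (simp_all add: frac_class_def fractions_def)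
qed

lemma Comp_frac_class:
  "\<lbrakk>composable C x v y; composable C y w z\<rbrakk> \<Longrightarrow>
    Comp (fractions C) (frac_class C y w z) (frac_class C x v y) = frac_class C x (v @ w) z"
  using F.Comp_class[of "(x, v, y)" "(y, w, z)"]
  by (simp add: frac_class_def fractions_def strings_def)

lemma Obj_fractions: "Obj (fractions C) = Obj C"
  and Id_fractions: "Id (fractions C) x = frac_class C x [] x"
  by (simp_all add: fractions_def F.Obj_Q F.Id_Q frac_class_def)

lemma fractions_cases:
  assumes "a \<in> Arr (fractions C)"
  obtains x w y where "composable C x w y" "a = frac_class C x w y"
proof -
  have "a \<in> strings C // frac_equiv C"
    using assms F.Arr_Q by (simp add: fractions_def)
  then obtain p where "p \<in> strings C" "a = frac_equiv C `` {p}" by (rule quotientE)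
  then show thesis using that by (auto simp: strings_def frac_class_def)
qed

lemma some_frac_class:
  "composable C x w y \<Longrightarrow> ((x, w, y), SOME p. p \<in> frac_class C x w y) \<in> frac_equiv C"
  unfolding frac_class_def by (rule F.some_in_class) (simp add: strings_def)

lemma frac_class_step:
  assumes "frac_step C v w" "composable C x v y" "composable C x w y"
  shows "frac_class C x v y = frac_class C x w y"
proof -
  have "((x, v, y), (x, w, y)) \<in> frac_equiv C"
    using assms by (auto simp: frac_equiv_def string_step_def strings_def)
  then show ?thesis unfolding frac_class_def by (rule equiv_class_eq[OF F.E])
qed

text \<open>The class of a concatenation is a composite in the groupoid, so it depends on the middle
  string only through its class.\<close>

lemma frac_class_context:
  assumes "frac_class C y v z = frac_class C y w z" "composable C y v z" "composable C y w z"
    and "composable C x a y" "composable C z b t"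
  shows "frac_class C x (a @ v @ b) t = frac_class C x (a @ w @ b) t"
proof -
  have "frac_class C x (a @ u @ b) t = Comp (fractions C) (frac_class C z b t)
      (Comp (fractions C) (frac_class C y u z) (frac_class C x a y))"
    if "composable C y u z" for u
    using that assms(4,5) Comp_frac_class[of x a y u z] Comp_frac_class[of x "a @ u" z b t]
    by (auto simp: composable_append)
  then show ?thesis using assms by simp
qed

text \<open>With \<open>i\<close> the identity, the string \<open>i, i, i\<^sup>-\<^sup>1\<close>
  reduces to \<open>i\<close> by cancelling its last two letters, and to
  \<open>i, i\<^sup>-\<^sup>1\<close>, hence to the empty string, by composing its first
  two.\<close>

lemma frac_class_Fwd_Id:
  assumes "x \<in> Obj C"
  shows "frac_class C x [Fwd (Id C x)] x = frac_class C x [] x"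
proof -
  let ?i = "Id C x"
  have i: "?i \<in> Arr C" "Dom C ?i = x" "Cod C ?i = x" "Comp C ?i ?i = ?i"
    using assms Comp_Id_left[of ?i] by (simp_all add: Id_closed Dom_Id Cod_Id)
  have "frac_class C x [Fwd ?i, Fwd ?i, Bwd ?i] x = frac_class C x [Fwd ?i] x"
    using i assms frac_step.cancel_fwd_bwd[of ?i C "[Fwd ?i]" "[]"] by (intro frac_class_step) simp_all
  moreover have "frac_class C x [Fwd ?i, Fwd ?i, Bwd ?i] x = frac_class C x [Fwd ?i, Bwd ?i] x"
    using i assms frac_step.comp_fwd[of ?i C ?i "[]" "[Bwd ?i]"] by (intro frac_class_step) simp_all
  moreover have "frac_class C x [Fwd ?i, Bwd ?i] x = frac_class C x [] x"
    using i assms frac_step.cancel_fwd_bwd[of ?i C "[]" "[]"] by (intro frac_class_step) simp_all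
  ultimately show ?thesis by simp
qed

lemma frac_class_Bwd_Id:
  assumes "x \<in> Obj C"
  shows "frac_class C x [Bwd (Id C x)] x = frac_class C x [] x"
proof -
  let ?i = "Id C x"
  have i: "?i \<in> Arr C" "Dom C ?i = x" "Cod C ?i = x"
    using assms by (simp_all add: Id_closed Dom_Id Cod_Id)
  have "frac_class C x [Fwd ?i, Bwd ?i] x = frac_class C x [Bwd ?i] x"
    using i assms frac_class_context[OF frac_class_Fwd_Id, of x x "[]" "[Bwd ?i]" x] by simp
  moreover have "frac_class C x [Fwd ?i, Bwd ?i] x = frac_class C x [] x"
    using i assms frac_step.cancel_fwd_bwd[of ?i C "[]" "[]"] by (intro frac_class_step) simp_all
  ultimately show ?thesis by simp
qed

text \<open>Inserting \<open>Fwd k, Bwd k\<close> between the two letters and composing on either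
  side pushes a cospan along \<open>k\<close>. It is used to compare the cospans at an edge and at a
  triangle containing it.\<close>

lemma frac_class_span_push:
  assumes "f \<in> Arr C" "g \<in> Arr C" "k \<in> Arr C" "Cod C f = Dom C k" "Cod C g = Dom C k"
  shows "frac_class C (Dom C f) [Fwd (Comp C k f), Bwd (Comp C k g)] (Dom C g) =
    frac_class C (Dom C f) [Fwd f, Bwd g] (Dom C g)"
proof -
  note c = assms Comp_closed Dom_Comp Cod_Comp Dom_closed Cod_closed
  have "frac_class C (Dom C f) [Fwd f, Fwd k, Bwd k, Bwd g] (Dom C g) =
      frac_class C (Dom C f) [Fwd (Comp C k f), Bwd k, Bwd g] (Dom C g)"
    using frac_step.comp_fwd[of f C k "[]" "[Bwd k, Bwd g]"] by (intro frac_class_step) (simp_all add: c)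
  also have "\<dots> = frac_class C (Dom C f) [Fwd (Comp C k f), Bwd (Comp C k g)] (Dom C g)"
    using frac_step.comp_bwd[of g C k "[Fwd (Comp C k f)]" "[]"] by (intro frac_class_step) (simp_all add: c)
  finally have "frac_class C (Dom C f) [Fwd f, Fwd k, Bwd k, Bwd g] (Dom C g) =
    frac_class C (Dom C f) [Fwd (Comp C k f), Bwd (Comp C k g)] (Dom C g)" .
  moreover have "frac_class C (Dom C f) [Fwd f, Fwd k, Bwd k, Bwd g] (Dom C g) =
      frac_class C (Dom C f) [Fwd f, Bwd g] (Dom C g)"
    using frac_step.cancel_fwd_bwd[of k C "[Fwd f]" "[Bwd g]"] by (intro frac_class_step) (simp_all add: c)
  ultimately show ?thesis by simp
qed

end

section \<open>Functors on non-empty subsets\<close>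

text \<open>The simplex of a cocone \<open>a\<close> with apex \<open>z\<close>: a singleton goes to
  the source of its arrow and every larger subset to \<open>z\<close>. \<open>Min A\<close> merely
  extracts the element of a singleton.\<close>

definition cone ::
    "('o, 'a) precategory \<Rightarrow> nat \<Rightarrow> (nat \<Rightarrow> 'a) \<Rightarrow> (nat set \<Rightarrow> 'o) \<times> (nat set \<times> nat set \<Rightarrow> 'a)" where
  "cone C n a =
    (let S = {A. A \<noteq> {} \<and> A \<subseteq> {..n}}; z = Cod C (a 0);
       v = (\<lambda>A. if card A = 1 then Dom C (a (Min A)) else z)
     in (restrict v S, \<lambda>(A, B)\<in>{(A, B). A \<in> S \<and> B \<in> S \<and> A \<subseteq> B}.
       if A = B then Id C (v A) else if card A = 1 then a (Min A) else Id C z))"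

text \<open>Pullback along the last-vertex map from non-empty subsets to the ordinal, which is
  monotone.\<close>

definition max_simplex ::
    "nat \<Rightarrow> (nat \<Rightarrow> 'o) \<times> (nat \<times> nat \<Rightarrow> 'a) \<Rightarrow> (nat set \<Rightarrow> 'o) \<times> (nat set \<times> nat set \<Rightarrow> 'a)" where
  "max_simplex n F =
    (let S = {A. A \<noteq> {} \<and> A \<subseteq> {..n}}
     in (\<lambda>A\<in>S. fst F (Max A), \<lambda>(A, B)\<in>{(A, B). A \<in> S \<and> B \<in> S \<and> A \<subseteq> B}. snd F (Max A, Max B)))"

lemma max_simplex:
  assumes "F \<in> functors (ordinal n) C"
  shows "max_simplex n F \<in> simp (tilde_sset C) n"
proof -
  note F = functors_order[OF assms[unfolded ordinal_def]]
  have M: "Max A \<le> n" if "A \<noteq> {}" "A \<subseteq> {..n}" for A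
    using that Max_in[of A] finite_subset[OF that(2)] by auto
  have mono: "Max A \<le> Max B" if "A \<noteq> {}" "B \<subseteq> {..n}" "A \<subseteq> B" for A B
    using that finite_subset[OF that(2)] by (simp add: Max_mono)
  have "max_simplex n F \<in> functors (order_category {A. A \<noteq> {} \<and> A \<subseteq> {..n}} (\<subseteq>)) C"
    unfolding max_simplex_def Let_def
  proof (rule functors_orderI, goal_cases)
    case (5 A B D)
    then have "A \<noteq> {}" "A \<subseteq> {..n}" "B \<noteq> {}" "B \<subseteq> {..n}" "D \<noteq> {}" "D \<subseteq> {..n}" "A \<subseteq> D" by auto
    then show ?case using 5(4,5) F(6)[of "Max A" "Max B" "Max D"] by (simp add: M mono)
  qed (auto simp: F(1-5) M mono)
  then show ?thesis by (simp add: tilde_sset_def subset_poset_def)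
qed

text \<open>An arrow of the subset poset that is not an identity never ends in a singleton, so
  \<open>cone\<close> sends its target to the apex.\<close>

lemma card_proper_subset:
  assumes "A \<noteq> {}" "A \<subset> B" "B \<subseteq> {..n::nat}"
  shows "card B \<noteq> 1"
  using assms psubset_card_mono[of B A] finite_subset[of B "{..n}"] finite_subset[of A B] card_gt_0_iff[of A]
  by auto

lemma (in category) cone:
  assumes a: "\<And>i. i \<le> n \<Longrightarrow> a i \<in> Arr C \<and> Cod C (a i) = Cod C (a 0)"
  shows "cone C n a \<in> simp (tilde_sset C) n"
proof -
  have m: "Min A \<le> n" if "A \<noteq> {}" "A \<subseteq> {..n}" for A
    using subsetD[OF that(2) Min_in[OF finite_subset[OF that(2)] that(1)]] by simp
  have aM: "a (Min A) \<in> Arr C" "Cod C (a (Min A)) = Cod C (a 0)" if "A \<noteq> {}" "A \<subseteq> {..n}" for A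
    using a[OF m[OF that]] by blast+
  have z: "Cod C (a 0) \<in> Obj C" using a[of 0] Cod_closed by blast
  have "cone C n a \<in> functors (order_category {A. A \<noteq> {} \<and> A \<subseteq> {..n}} (\<subseteq>)) C"
    unfolding cone_def Let_def
  proof (rule functors_orderI, goal_cases)
    case (3 A)
    then show ?case using aM[of A] z Dom_closed by simp
  next
    case (4 A B)
    then show ?case
      using aM[of A] z Dom_closed[OF aM(1)[of A]] card_proper_subset[of A B n]
      by (auto simp: Id_closed Dom_Id Cod_Id)
  next
    case (5 A B D)
    then have A: "A \<noteq> {}" "A \<subseteq> {..n}" "B \<noteq> {}" "B \<subseteq> {..n}" "D \<subseteq> {..n}" "A \<subseteq> D" by auto
    have II: "Comp C (Id C x) (Id C x) = Id C x" if "x \<in> Obj C" for x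
      using that Comp_Id_left[of "Id C x"] by (simp add: Id_closed Cod_Id)
    note aM = aM[OF A(1,2)]
    have aI: "Comp C (Id C (Cod C (a 0))) (a (Min A)) = a (Min A)"
      "Comp C (a (Min A)) (Id C (Dom C (a (Min A)))) = a (Min A)"
      using Comp_Id_left Comp_Id_right aM by metis+
    \<comment> \<open>If one arrow is an identity, a unit law remains. Otherwise \<open>B\<close>
      and \<open>D\<close> both go to the apex and the second arrow becomes its unit.\<close>
    consider "A = B" | "A \<noteq> B" "B = D" | "A \<subset> B" "B \<subset> D" "A \<noteq> D" using 5(4,5) by blast
    then show ?case
    proof cases
      case 1
      then show ?thesis using 5(1-5) aI aM II[OF z] II[OF Dom_closed[OF aM(1)]] by auto
    next
      case 2
      then show ?thesis
        using 5(1-5) card_proper_subset[of A B n] A aI II[OF z] by auto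
    next
      case 3
      then have "card B \<noteq> 1" "card D \<noteq> 1"
        using A card_proper_subset[of A B n] card_proper_subset[of B D n] by blast+
      then show ?thesis using 3 5(1-5) A(6) aI II[OF z] by simp
    qed
  qed simp_all
  then show ?thesis by (simp add: tilde_sset_def subset_poset_def)
qed

lemma snd_act_tilde:
  "\<lbrakk>A \<noteq> {}; A \<subseteq> B; B \<subseteq> {..m}\<rbrakk> \<Longrightarrow>
    snd (act (tilde_sset C) m n f F) (A, B) = snd F (f ` A, f ` B)"
  by (auto simp: tilde_sset_def subset_poset_def order_category_def)

lemma fst_act_tilde:
  "\<lbrakk>A \<noteq> {}; A \<subseteq> {..m}\<rbrakk> \<Longrightarrow> fst (act (tilde_sset C) m n f F) A = fst F (f ` A)"
  by (auto simp: tilde_sset_def subset_poset_def order_category_def)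

lemma tilde_simplex_iff:
  "F \<in> simp (tilde_sset C) n \<longleftrightarrow>
    F \<in> functors (order_category {A. A \<noteq> {} \<and> A \<subseteq> {..n}} (\<subseteq>)) C"
  by (simp add: tilde_sset_def subset_poset_def)

lemma nonempty_subsets_1: "{A. A \<noteq> {} \<and> A \<subseteq> {..1::nat}} = {{0}, {1}, {0, 1}}"
proof -
  have "{A. A \<noteq> {} \<and> A \<subseteq> {..1::nat}} = Pow {0, 1} - {{}}" by (auto simp: le_Suc_eq)
  also have "\<dots> = {{0}, {1}, {0, 1}}" unfolding Pow_insert Pow_empty by auto
  finally show ?thesis .
qed

lemma tilde_1_eqI:
  assumes F: "F \<in> simp (tilde_sset C) 1" and G: "G \<in> simp (tilde_sset C) 1"
    and eq: "snd F ({0}, {0, 1}) = snd G ({0}, {0, 1})" "snd F ({1}, {0, 1}) = snd G ({1}, {0, 1})"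
  shows "F = G"
proof -
  note F' = F[unfolded tilde_simplex_iff nonempty_subsets_1]
    and G' = G[unfolded tilde_simplex_iff nonempty_subsets_1]
  have "fst F {0} = fst G {0}" "fst F {1} = fst G {1}" "fst F {0, 1} = fst G {0, 1}"
    using functors_order(3,4)[OF F', of "{0}" "{0, 1}"] functors_order(3,4)[OF G', of "{0}" "{0, 1}"]
      functors_order(3)[OF F', of "{1}" "{0, 1}"] functors_order(3)[OF G', of "{1}" "{0, 1}"] eq
    by simp_all
  then show ?thesis
    by (intro functors_order_eqI[OF F' G']) (auto simp del: One_nat_def simp: eq)
qed

section \<open>Fractions as labels of 1-simplices\<close>

definition cospan_class ::
    "('o, 'a) precategory \<Rightarrow> (nat set \<Rightarrow> 'o) \<times> (nat set \<times> nat set \<Rightarrow> 'a) \<Rightarrow>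
     ('o \<times> 'a letter list \<times> 'o) set" where
  "cospan_class C b =
    frac_class C (fst b {0}) [Fwd (snd b ({0}, {0, 1})), Bwd (snd b ({1}, {0, 1}))] (fst b {1})"

definition cospan :: "('o, 'a) precategory \<Rightarrow> 'a \<Rightarrow> 'a \<Rightarrow>
    (nat set \<Rightarrow> 'o) \<times> (nat set \<times> nat set \<Rightarrow> 'a)" where
  "cospan C f g = cone C 1 (\<lambda>i. if i = 0 then f else g)"

fun letter_simplex :: "('o, 'a) precategory \<Rightarrow> 'a letter \<Rightarrow>
    (nat set \<Rightarrow> 'o) \<times> (nat set \<times> nat set \<Rightarrow> 'a)" where
  "letter_simplex C (Fwd f) = cospan C f (Id C (Cod C f))"
| "letter_simplex C (Bwd f) = cospan C (Id C (Cod C f)) f"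

text \<open>The leading identity is needed because paths are non-empty, while strings may be empty.\<close>

fun string_path :: "('o, 'a) precategory \<Rightarrow> 'o \<times> 'a letter list \<times> 'o \<Rightarrow>
    ((nat set \<Rightarrow> 'o) \<times> (nat set \<times> nat set \<Rightarrow> 'a)) list" where
  "string_path C (x, w, y) = map (letter_simplex C) (Fwd (Id C x) # w)"

context category
begin

context
  notes [simp del] = One_nat_def
begin

interpretation T: symmetric_sset "tilde_sset C" by (rule symmetric_sset_tilde)

lemma tilde_arrow:
  assumes "F \<in> simp (tilde_sset C) n" "A \<noteq> {}" "A \<subseteq> B" "B \<subseteq> {..n}"
  shows "snd F (A, B) \<in> Arr C" "Dom C (snd F (A, B)) = fst F A" "Cod C (snd F (A, B)) = fst F B"
  using functors_order(2-4)[OF assms(1)[unfolded tilde_simplex_iff], of A B] assms by auto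

lemma tilde_Comp:
  assumes "F \<in> simp (tilde_sset C) n" "A \<noteq> {}" "A \<subseteq> B" "B \<subseteq> D" "D \<subseteq> {..n}"
  shows "snd F (A, D) = Comp C (snd F (B, D)) (snd F (A, B))"
  using functors_order(6)[OF assms(1)[unfolded tilde_simplex_iff], of A B D] assms by auto

lemma vertex_face_1:
  "fst (face (tilde_sset C) 1 i F) {0} = fst F {if 0 < i then 0 else 1}"
  by (simp add: T.face_1 fst_act_tilde) (simp add: One_nat_def)

lemma vertex_face_2:
  "fst (face (tilde_sset C) 2 i F) {0} = fst F {if 0 < i then 0 else 1}"
  "fst (face (tilde_sset C) 2 i F) {1} = fst F {if 1 < i then 1 else 2}"
  by (simp_all add: T.face_2 fst_act_tilde) (simp_all add: One_nat_def)

lemma edge_face_2: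
  "snd (face (tilde_sset C) 2 i F) ({0}, {0, 1}) =
    snd F ({if 0 < i then 0 else 1}, {if 0 < i then 0 else 1, if 1 < i then 1 else 2})"
  "snd (face (tilde_sset C) 2 i F) ({1}, {0, 1}) =
    snd F ({if 1 < i then 1 else 2}, {if 0 < i then 0 else 1, if 1 < i then 1 else 2})"
  by (simp_all add: T.face_2 snd_act_tilde) (simp_all add: One_nat_def)

text \<open>For the triangle condition, all three cospans are pushed to the barycentre of the
  triangle. There the leg from vertex 1 occurs backwards and then forwards in the composite, and
  cancels.\<close>

lemma groupoid_cocycle_tilde:
  "groupoid_cocycle (tilde_sset C) (fractions C) (\<lambda>F. fst F {0}) (cospan_class C)"
proof (intro groupoid_cocycle.intro groupoid_cocycle_axioms.intro symmetric_sset_tilde groupoid_fractions)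
  have S: "{A. A \<noteq> {} \<and> A \<subseteq> {..0::nat}} = {{0}}" by auto
  show "bij_betw (\<lambda>F. fst F {0}) (simp (tilde_sset C) 0) (Obj (fractions C))"
    unfolding bij_betw_def Obj_fractions
  proof
    show "inj_on (\<lambda>F. fst F {0}) (simp (tilde_sset C) 0)"
    proof (rule inj_onI)
      fix F G assume "F \<in> simp (tilde_sset C) 0" "G \<in> simp (tilde_sset C) 0" "fst F {0} = fst G {0}"
      then show "F = G"
        unfolding tilde_simplex_iff S by (elim functors_order_eqI) auto
    qed
    show "(\<lambda>F. fst F {0}) ` simp (tilde_sset C) 0 = Obj C"
    proof
      show "(\<lambda>F. fst F {0}) ` simp (tilde_sset C) 0 \<subseteq> Obj C"
        by (auto simp: tilde_simplex_iff S intro: functors_order(1))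
      show "Obj C \<subseteq> (\<lambda>F. fst F {0}) ` simp (tilde_sset C) 0"
      proof
        fix x assume "x \<in> Obj C"
        then have "(\<lambda>i\<in>{{0 :: nat}}. x, \<lambda>(i, j)\<in>{(i, j). i \<in> {{0}} \<and> j \<in> {{0}} \<and> i \<subseteq> j}. Id C x)
            \<in> simp (tilde_sset C) 0"
          unfolding tilde_simplex_iff S by (intro constant_functor) (auto intro: reflpI transpI)
        then show "x \<in> (\<lambda>F. fst F {0}) ` simp (tilde_sset C) 0"
          by (rule image_eqI[rotated]) simp
      qed
    qed
  qed
  fix b assume b: "b \<in> simp (tilde_sset C) 1"
  have "composable C (fst b {0}) [Fwd (snd b ({0}, {0, 1})), Bwd (snd b ({1}, {0, 1}))] (fst b {1})"
    using tilde_arrow[OF b, of "{0}" "{0, 1}"] tilde_arrow[OF b, of "{1}" "{0, 1}"]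
      functors_order(1)[OF b[unfolded tilde_simplex_iff], of "{1}"] by simp
  note this [THEN frac_class(1)] this [THEN frac_class(2)] this [THEN frac_class(3)]
  then show "cospan_class C b \<in> Arr (fractions C)"
    "Dom (fractions C) (cospan_class C b) = fst (face (tilde_sset C) 1 1 b) {0}"
    "Cod (fractions C) (cospan_class C b) = fst (face (tilde_sset C) 1 0 b) {0}"
    by (simp_all add: cospan_class_def vertex_face_1)
next
  fix c assume c: "c \<in> simp (tilde_sset C) 2"
  let ?t = "{0, 1, 2} :: nat set"
  note arr = tilde_arrow[OF c] and comp = tilde_Comp[OF c]
  have obj: "fst c {i} \<in> Obj C" if "i \<le> 2" for i
    using functors_order(1)[OF c[unfolded tilde_simplex_iff], of "{i}"] that by simp
  \<comment> \<open>The map from the barycentre of an edge to that of the triangle does not change the class.\<close>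
  have push: "frac_class C (fst c {i}) [Fwd (snd c ({i}, {i, j})), Bwd (snd c ({j}, {i, j}))] (fst c {j}) =
      frac_class C (fst c {i}) [Fwd (snd c ({i}, ?t)), Bwd (snd c ({j}, ?t))] (fst c {j})"
    if "i \<in> ?t" "j \<in> ?t" for i j
  proof -
    have "{i, j} \<subseteq> ?t" "?t \<subseteq> {..2}" "{i, j} \<subseteq> {..2}" using that by auto
    then show ?thesis
      using frac_class_span_push[of "snd c ({i}, {i, j})" "snd c ({j}, {i, j})" "snd c ({i, j}, ?t)"]
        comp[of "{i}" "{i, j}" ?t] comp[of "{j}" "{i, j}" ?t] arr[of "{i}" "{i, j}"]
        arr[of "{j}" "{i, j}"] arr[of "{i, j}" ?t] by simp
  qed
  have t: "snd c ({i}, ?t) \<in> Arr C" "Dom C (snd c ({i}, ?t)) = fst c {i}"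
    "Cod C (snd c ({i}, ?t)) = fst c ?t" if "i \<in> ?t" for i
    using arr[of "{i}" ?t] that by auto
  have "cospan_class C (face (tilde_sset C) 2 1 c) =
      frac_class C (fst c {0}) [Fwd (snd c ({0}, ?t)), Bwd (snd c ({2}, ?t))] (fst c {2})"
    using push[of 0 2] by (simp add: cospan_class_def vertex_face_2 edge_face_2)
  \<comment> \<open>The cancelling pair through vertex 1 is inserted.\<close>
  also have "\<dots> = frac_class C (fst c {0}) ([Fwd (snd c ({0}, ?t)), Bwd (snd c ({1}, ?t))] @
      [Fwd (snd c ({1}, ?t)), Bwd (snd c ({2}, ?t))]) (fst c {2})"
    using frac_step.cancel_bwd_fwd[of "snd c ({1}, ?t)" C "[Fwd (snd c ({0}, ?t))]" "[Bwd (snd c ({2}, ?t))]"]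
    by (intro frac_class_step[symmetric]) (simp_all add: t obj)
  also have "\<dots> = Comp (fractions C)
      (frac_class C (fst c {1}) [Fwd (snd c ({1}, ?t)), Bwd (snd c ({2}, ?t))] (fst c {2}))
      (frac_class C (fst c {0}) [Fwd (snd c ({0}, ?t)), Bwd (snd c ({1}, ?t))] (fst c {1}))"
    by (intro Comp_frac_class[symmetric]) (simp_all add: t obj)
  also have "\<dots> = Comp (fractions C) (cospan_class C (face (tilde_sset C) 2 0 c))
      (cospan_class C (face (tilde_sset C) 2 2 c))"
    using push[of 0 1] push[of 1 2] by (simp add: cospan_class_def vertex_face_2 edge_face_2)
  finally show "cospan_class C (face (tilde_sset C) 2 1 c) =
      Comp (fractions C) (cospan_class C (face (tilde_sset C) 2 0 c))
        (cospan_class C (face (tilde_sset C) 2 2 c))" .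
qed

interpretation R: groupoid_cocycle "tilde_sset C" "fractions C" "\<lambda>F. fst F {0}" "cospan_class C"
  by (rule groupoid_cocycle_tilde)

section \<open>Cospans and letters as 1-simplices\<close>

lemma snd_cone:
  "\<lbrakk>i \<le> n; B \<subseteq> {..n}; i \<in> B; B \<noteq> {i}\<rbrakk> \<Longrightarrow> snd (cone C n a) ({i}, B) = a i"
  by (auto simp: cone_def Let_def)

lemma fst_cone: "i \<le> n \<Longrightarrow> fst (cone C n a) {i} = Dom C (a i)"
  by (simp add: cone_def Let_def)

lemma cospan:
  assumes "f \<in> Arr C" "g \<in> Arr C" "Cod C f = Cod C g"
  shows "cospan C f g \<in> simp (tilde_sset C) 1"
    "snd (cospan C f g) ({0}, {0, 1}) = f" "snd (cospan C f g) ({1}, {0, 1}) = g"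
    "fst (cospan C f g) {0} = Dom C f" "fst (cospan C f g) {1} = Dom C g"
  using assms by (auto simp: cospan_def snd_cone fst_cone intro!: cone)

lemma cospan_eqI:
  assumes "F \<in> simp (tilde_sset C) 1" "snd F ({0}, {0, 1}) = f" "snd F ({1}, {0, 1}) = g"
  shows "F = cospan C f g"
proof -
  have "f \<in> Arr C" "g \<in> Arr C" "Cod C f = Cod C g"
    using tilde_arrow[OF assms(1), of "{0}" "{0, 1}"] tilde_arrow[OF assms(1), of "{1}" "{0, 1}"] assms(2,3)
    by auto
  then show ?thesis using assms cospan by (intro tilde_1_eqI) simp_all
qed

lemma swap_cospan:
  assumes "f \<in> Arr C" "g \<in> Arr C" "Cod C f = Cod C g"
  shows "swap (tilde_sset C) 1 0 (cospan C f g) = cospan C g f"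
  using cospan[OF assms] T.swap_in[OF cospan(1)[OF assms]]
  by (intro cospan_eqI) (simp_all add: swap_def snd_act_tilde insert_commute One_nat_def)

lemma degen_tilde:
  assumes "x \<in> simp (tilde_sset C) 0"
  shows "degen (tilde_sset C) 0 0 x = cospan C (Id C (fst x {0})) (Id C (fst x {0}))"
  using T.degen_0_in[OF assms] functors_order(5)[OF assms[unfolded tilde_simplex_iff], of "{0}"]
  by (intro cospan_eqI) (simp_all add: T.degen_0 snd_act_tilde)

text \<open>The label is the class of the letter itself, because the other leg of the cospan is an
  identity and drops out of the string.\<close>

lemma letter_simplex:
  assumes "letter_arr l \<in> Arr C"
  shows "letter_simplex C l \<in> simp (tilde_sset C) 1"
    "fst (face (tilde_sset C) 1 1 (letter_simplex C l)) {0} = letter_dom C l"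
    "fst (face (tilde_sset C) 1 0 (letter_simplex C l)) {0} = letter_cod C l"
    "cospan_class C (letter_simplex C l) = frac_class C (letter_dom C l) [l] (letter_cod C l)"
proof -
  let ?f = "letter_arr l" and ?i = "Id C (Cod C (letter_arr l))"
  have i: "?i \<in> Arr C" "Dom C ?i = Cod C ?f" "Cod C ?i = Cod C ?f" "Cod C ?f \<in> Obj C" "Dom C ?f \<in> Obj C"
    using assms by (simp_all add: Id_closed Dom_Id Cod_Id Cod_closed Dom_closed)
  note c = cospan[OF assms i(1)] cospan[OF i(1) assms]
  show "letter_simplex C l \<in> simp (tilde_sset C) 1"
    "fst (face (tilde_sset C) 1 1 (letter_simplex C l)) {0} = letter_dom C l"
    "fst (face (tilde_sset C) 1 0 (letter_simplex C l)) {0} = letter_cod C l"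
    using c i by (cases l; simp add: vertex_face_1)+
  show "cospan_class C (letter_simplex C l) = frac_class C (letter_dom C l) [l] (letter_cod C l)"
    using assms c i
      frac_class_context[OF frac_class_Bwd_Id[OF i(4)], of "Dom C ?f" "[Fwd ?f]" "[]" "Cod C ?f"]
      frac_class_context[OF frac_class_Fwd_Id[OF i(4)], of "Cod C ?f" "[]" "[Bwd ?f]" "Dom C ?f"]
    by (cases l) (simp_all add: cospan_class_def)
qed

section \<open>Paths of strings and their holonomy\<close>

lemma map_letter_simplex:
  assumes "composable C x w y" "w \<noteq> []"
  shows "map (letter_simplex C) w \<in> paths (tilde_sset C)"
    "fst (path_source (tilde_sset C) (map (letter_simplex C) w)) {0} = x"
    "fst (path_target (tilde_sset C) (map (letter_simplex C) w)) {0} = y"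
proof -
  have "map (letter_simplex C) w \<in> paths (tilde_sset C) \<and>
    fst (path_source (tilde_sset C) (map (letter_simplex C) w)) {0} = x \<and>
    fst (path_target (tilde_sset C) (map (letter_simplex C) w)) {0} = y"
    using assms
  proof (induction w arbitrary: x)
    case (Cons l w)
    then have l: "letter_arr l \<in> Arr C" and x: "letter_dom C l = x"
      and w: "composable C (letter_cod C l) w y" by simp_all
    show ?case
    proof (cases "w = []")
      case True
      then show ?thesis using w x letter_simplex[OF l] by (simp add: T.path_singleton)
    next
      case False
      note IH = Cons.IH[OF w False]
      \<comment> \<open>Consecutive simplices must meet in the same 0-simplex, that is, in the same
        functor; by injectivity it suffices to compare objects.\<close>
      have "face (tilde_sset C) 1 0 (letter_simplex C l) =
          path_source (tilde_sset C) (map (letter_simplex C) w)"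
        using IH letter_simplex[OF l] T.path_ends_in T.ends by (intro R.vert_inj) simp_all
      then show ?thesis
        using IH False x letter_simplex[OF l]
        by (simp add: R.paths_Cons path_source_def path_target_def)
    qed
  qed simp
  then show "map (letter_simplex C) w \<in> paths (tilde_sset C)"
    "fst (path_source (tilde_sset C) (map (letter_simplex C) w)) {0} = x"
    "fst (path_target (tilde_sset C) (map (letter_simplex C) w)) {0} = y" by simp_all
qed

lemma composable_Fwd_Id: "composable C x w y \<Longrightarrow> composable C x (Fwd (Id C x) # w) y"
  using composable_Obj[of x w y] by (simp add: Id_closed Dom_Id Cod_Id)

lemma string_path:
  assumes "composable C x w y"
  shows "string_path C (x, w, y) \<in> paths (tilde_sset C)"
    "fst (path_source (tilde_sset C) (string_path C (x, w, y))) {0} = x"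
    "fst (path_target (tilde_sset C) (string_path C (x, w, y))) {0} = y"
  using map_letter_simplex[OF composable_Fwd_Id[OF assms]] by simp_all

lemma holonomy_string_path:
  assumes "composable C x w y"
  shows "R.holonomy (string_path C (x, w, y)) = frac_class C x w y"
proof -
  \<comment> \<open>Composing with the label of a letter appends this letter to the string read so
    far. The prefix \<open>v\<close> is arbitrary for the induction.\<close>
  have run: "R.run (frac_class C x v z) (map (letter_simplex C) w) = frac_class C x (v @ w) y"
    if "composable C x v z" "composable C z w y" for x v z w y
    using that
  proof (induction w arbitrary: v z)
    case Nil
    then show ?case by (simp add: R.run_simps)
  next
    case (Cons l w)
    then have l: "composable C z [l] (letter_cod C l)" "letter_arr l \<in> Arr C" "letter_dom C l = z"
      using composable_Obj by auto
    then have "composable C x (v @ [l]) (letter_cod C l)"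
      using Cons.prems(1) by (auto simp: composable_append)
    then show ?case
      using Cons.IH[of "v @ [l]" "letter_cod C l"] Cons.prems Comp_frac_class[OF Cons.prems(1) l(1)]
        letter_simplex(4)[OF l(2)] l(3)
      by (simp add: R.run_simps)
  qed
  have x: "x \<in> Obj C" using assms composable_Obj by blast
  have "R.holonomy (string_path C (x, w, y)) = frac_class C x ([] @ (Fwd (Id C x) # w)) y"
    using run[of x "[]" x "Fwd (Id C x) # w" y] x composable_Fwd_Id[OF assms] string_path(2)[OF assms]
    by (simp add: R.holonomy_def Id_fractions)
  also have "\<dots> = frac_class C x w y"
    using frac_class_context[OF frac_class_Fwd_Id[OF x], of x "[]" w y] x assms
    by (simp add: Id_closed Dom_Id Cod_Id)
  finally show ?thesis .
qed

text \<open>Identifies the units of the homotopy groupoid with the identity letters that stand at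
  the front of every \<open>string_path\<close>.\<close>

lemma degen_path_ends:
  assumes "p \<in> paths (tilde_sset C)"
  shows "degen (tilde_sset C) 0 0 (path_target (tilde_sset C) p) =
    letter_simplex C (Fwd (Id C (fst (path_target (tilde_sset C) p) {0})))"
    "degen (tilde_sset C) 0 0 (path_source (tilde_sset C) p) =
    letter_simplex C (Fwd (Id C (fst (path_source (tilde_sset C) p) {0})))"
  using T.path_ends_in[OF assms] R.vert_Obj by (simp_all add: degen_tilde Obj_fractions Cod_Id)

section \<open>Relations between strings as homotopies\<close>

lemma swap_letter_simplex:
  "letter_arr l \<in> Arr C \<Longrightarrow> swap (tilde_sset C) 1 0 (letter_simplex C l) = letter_simplex C (flip l)"
  by (cases l) (simp_all add: swap_cospan Id_closed Cod_Id Cod_closed)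

text \<open>In the simplex pulled back along the maximum, an edge subset goes to its larger vertex,
  so the leg from that vertex is a unit and each face is the simplex of a forward letter. The
  relation for backward letters comes from the reversed triangle.\<close>

lemma chain_homotopy:
  assumes "f \<in> Arr C" "g \<in> Arr C" "Dom C g = Cod C f"
  shows "([letter_simplex C (Fwd f), letter_simplex C (Fwd g)],
      [letter_simplex C (Fwd (Comp C g f))]) \<in> homotopy (tilde_sset C)"
    "([letter_simplex C (Bwd g), letter_simplex C (Bwd f)],
      [letter_simplex C (Bwd (Comp C g f))]) \<in> homotopy (tilde_sset C)"
proof -
  let ?c = "max_simplex 2 (chain C f g)"
  have c: "?c \<in> simp (tilde_sset C) 2" by (rule max_simplex[OF chain[OF assms]])
  note f = T.face_in_2[OF c]
  have snd_c: "snd ?c ({i}, {i, j}) = snd (chain C f g) (i, max i j)"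
    "snd ?c ({j}, {i, j}) = snd (chain C f g) (j, max i j)" if "i \<le> 2" "j \<le> 2" for i j
    using that by (simp_all add: max_simplex_def)
  have faces: "face (tilde_sset C) 2 2 ?c = letter_simplex C (Fwd f)"
    "face (tilde_sset C) 2 0 ?c = letter_simplex C (Fwd g)"
    "face (tilde_sset C) 2 1 ?c = letter_simplex C (Fwd (Comp C g f))"
    unfolding letter_simplex.simps
    using f assms by (intro cospan_eqI; simp add: edge_face_2 snd_c chain_simps Cod_Comp)+
  show "([letter_simplex C (Fwd f), letter_simplex C (Fwd g)],
      [letter_simplex C (Fwd (Comp C g f))]) \<in> homotopy (tilde_sset C)"
    using T.homotopy_sym[OF T.homotopy_triangle[OF c]] unfolding faces .
  show "([letter_simplex C (Bwd g), letter_simplex C (Bwd f)],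
      [letter_simplex C (Bwd (Comp C g f))]) \<in> homotopy (tilde_sset C)"
    using T.homotopy_sym[OF T.homotopy_triangle_swap[OF c, folded One_nat_def]] assms
    unfolding faces by (simp add: swap_letter_simplex Comp_closed del: letter_simplex.simps)
qed

lemma homotopy_string_path_context:
  assumes "composable C x (a @ v @ b) y"
    and "(string_path C (x, a @ v, z), string_path C (x, a @ w, z)) \<in> homotopy (tilde_sset C)"
  shows "(string_path C (x, a @ v @ b, y), string_path C (x, a @ w @ b, y)) \<in> homotopy (tilde_sset C)"
proof -
  have "string_path C (x, a @ v, z) @ map (letter_simplex C) b \<in> paths (tilde_sset C)"
    using string_path(1)[OF assms(1)] by simp
  from T.homotopy_extend_right[OF assms(2) this] show ?thesis by simp
qed

lemma homotopy_string_path_replace: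
  assumes c: "composable C x (a @ v @ b) y"
    and h: "(map (letter_simplex C) v, map (letter_simplex C) w) \<in> homotopy (tilde_sset C)"
  shows "(string_path C (x, a @ v @ b, y), string_path C (x, a @ w @ b, y)) \<in> homotopy (tilde_sset C)"
proof -
  obtain z where "composable C x (a @ v) z"
    using c composable_append[of x "a @ v" b y] by auto
  then have "map (letter_simplex C) (Fwd (Id C x) # a) @ map (letter_simplex C) v \<in> paths (tilde_sset C)"
    using string_path(1) by fastforce
  from T.homotopy_extend_left[OF h this] show ?thesis
    by (intro homotopy_string_path_context[OF c, where z = z]) simp
qed

text \<open>Cancelling may leave no letters at all, so the pair is absorbed by the path of
  \<open>a\<close>, which its leading identity keeps non-empty.\<close>

lemma homotopy_string_path_cancel:
  assumes c: "composable C x (a @ [l, flip l] @ b) y"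
  shows "(string_path C (x, a @ [l, flip l] @ b, y), string_path C (x, a @ b, y)) \<in> homotopy (tilde_sset C)"
proof -
  have l: "letter_arr l \<in> Arr C" and a: "composable C x a (letter_dom C l)"
    using c by (auto simp: composable_append)
  have "path_target (tilde_sset C) (string_path C (x, a, letter_dom C l)) =
      face (tilde_sset C) 1 1 (letter_simplex C l)"
    using string_path[OF a] letter_simplex[OF l] T.path_ends_in T.ends
    by (intro R.vert_inj) (simp_all del: string_path.simps)
  then have "(string_path C (x, a, letter_dom C l) @ [letter_simplex C l, letter_simplex C (flip l)],
      string_path C (x, a, letter_dom C l)) \<in> homotopy (tilde_sset C)"
    using T.homotopy_cancel_right[OF string_path(1)[OF a] letter_simplex(1)[OF l]]
      swap_letter_simplex[OF l] by simp
  then show ?thesis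
    using homotopy_string_path_context[OF c, of "letter_dom C l" "[]"] by simp
qed

lemma homotopy_string_step:
  assumes "string_step C p q"
  shows "(string_path C p, string_path C q) \<in> homotopy (tilde_sset C)"
proof -
  obtain x v w y where p: "p = (x, v, y)" and q: "q = (x, w, y)" and c: "composable C x v y"
    and step: "frac_step C v w"
    using assms by (auto simp: string_step_def strings_def)
  show ?thesis
    using step
  proof cases
    case (comp_fwd f g a b)
    then show ?thesis
      using c chain_homotopy(1)[of f g] unfolding p q
      by (simp only:) (intro homotopy_string_path_replace; simp)
  next
    case (comp_bwd f g a b)
    then show ?thesis
      using c chain_homotopy(2)[of f g] unfolding p q
      by (simp only:) (intro homotopy_string_path_replace; simp)
  next
    case (cancel_fwd_bwd f a b)
    then show ?thesis
      using c homotopy_string_path_cancel[of x a "Fwd f" b y] unfolding p q by simp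
  next
    case (cancel_bwd_fwd f a b)
    then show ?thesis
      using c homotopy_string_path_cancel[of x a "Bwd f" b y] unfolding p q by simp
  qed
qed

lemma homotopy_string_equiv:
  assumes "(p, q) \<in> frac_equiv C"
  shows "(string_path C p, string_path C q) \<in> homotopy (tilde_sset C)"
proof -
  have "equivclp (string_step C) p q" "p \<in> strings C" using assms by (auto simp: frac_equiv_def)
  then show ?thesis
  proof (induction rule: equivclp_induct)
    case base
    then show ?case using string_path(1)
      by (auto simp: strings_def intro!: T.homotopy_refl simp del: string_path.simps)
  next
    case (step q r)
    then show ?case
      using homotopy_string_step T.homotopy_sym T.homotopy_trans by metis
  qed
qed

text \<open>The concatenated paths differ from the path of \<open>v @ w\<close> by the identity
  letter at the junction, which is a unit absorbed by the first path.\<close>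

lemma homotopy_string_path_append:
  assumes "composable C x v y" "composable C y w z"
  shows "(string_path C (x, v, y) @ string_path C (y, w, z), string_path C (x, v @ w, z))
    \<in> homotopy (tilde_sset C)"
proof -
  let ?p = "string_path C (x, v, y)"
  note v = string_path[OF assms(1)]
  have "(?p @ [letter_simplex C (Fwd (Id C y))], ?p) \<in> homotopy (tilde_sset C)"
    using T.homotopy_unit_right[OF v(1)] degen_path_ends(1)[OF v(1)] v(3)
    by (simp del: string_path.simps letter_simplex.simps)
  moreover have "path_target (tilde_sset C) ?p = path_source (tilde_sset C) (string_path C (y, w, z))"
    using v string_path[OF assms(2)] T.path_ends_in by (intro R.vert_inj) (simp_all del: string_path.simps)
  then have "?p @ string_path C (y, w, z) \<in> paths (tilde_sset C)"
    using v(1) string_path(1)[OF assms(2)] T.path_nonempty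
    by (simp add: T.paths_append del: string_path.simps)
  then have "(?p @ [letter_simplex C (Fwd (Id C y))]) @ map (letter_simplex C) w \<in> paths (tilde_sset C)"
    by simp
  ultimately have "((?p @ [letter_simplex C (Fwd (Id C y))]) @ map (letter_simplex C) w,
      ?p @ map (letter_simplex C) w) \<in> homotopy (tilde_sset C)"
    by (rule T.homotopy_extend_right)
  then show ?thesis by simp
qed

lemma homotopy_cospan:
  assumes b: "b \<in> simp (tilde_sset C) 1"
  shows "([letter_simplex C (Fwd (snd b ({0}, {0, 1}))), letter_simplex C (Bwd (snd b ({1}, {0, 1})))], [b])
    \<in> homotopy (tilde_sset C)"
proof -
  let ?f = "snd b ({0}, {0, 1})" and ?g = "snd b ({1}, {0, 1})"
  have fg: "?f \<in> Arr C" "?g \<in> Arr C" "Cod C ?g = Cod C ?f"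
    using tilde_arrow[OF b, of "{0}" "{0, 1}"] tilde_arrow[OF b, of "{1}" "{0, 1}"] by auto
  \<comment> \<open>Vertices 0 and 2 carry the legs of \<open>b\<close>, and vertex 1 is their
    common target with its identity. Face 1 is then \<open>b\<close>, and faces 2 and 0 are the
    simplices of the two letters.\<close>
  let ?a = "\<lambda>i::nat. if i = 0 then ?f else if i = 1 then Id C (Cod C ?f) else ?g"
  let ?c = "cone C 2 ?a"
  have c: "?c \<in> simp (tilde_sset C) 2"
    using fg by (intro cone) (simp add: Id_closed Cod_Id Cod_closed)
  have c_edge: "snd ?c ({i}, {i, j}) = ?a i" "snd ?c ({j}, {i, j}) = ?a j"
    if "i \<le> 2" "j \<le> 2" "i \<noteq> j" for i j
    using that by (auto simp: snd_cone)
  note face = T.face_in_2[OF c]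
  have "face (tilde_sset C) 2 1 ?c = b"
    using face b by (intro tilde_1_eqI) (simp_all add: edge_face_2 c_edge)
  moreover have "face (tilde_sset C) 2 2 ?c = letter_simplex C (Fwd ?f)"
    "face (tilde_sset C) 2 0 ?c = letter_simplex C (Bwd ?g)"
    unfolding letter_simplex.simps using face fg
    by (intro cospan_eqI; simp add: edge_face_2 c_edge)+
  ultimately show ?thesis using T.homotopy_sym[OF T.homotopy_triangle[OF c]] by metis
qed

text \<open>The chosen path of a class is that of some representative. Equivalent strings have
  homotopic paths, so every condition can be checked on a convenient representative:
  \<open>v @ w\<close> for a composite, and the two legs for the label of a 1-simplex.\<close>

lemma isomorphic_homotopy_groupoid_tilde:
  "isomorphic_groupoids (homotopy_groupoid (tilde_sset C)) (fractions C)"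
proof (rule R.isomorphic_homotopy_groupoid[where g = "\<lambda>a. string_path C (SOME p. p \<in> a)"])
  have some: "(string_path C (x, w, y), string_path C (SOME p. p \<in> frac_class C x w y))
      \<in> homotopy (tilde_sset C)" if "composable C x w y" for x w y
    by (rule homotopy_string_equiv[OF some_frac_class[OF that]])
  fix a assume "a \<in> Arr (fractions C)"
  then obtain x v y where v: "composable C x v y" "a = frac_class C x v y" by (rule fractions_cases)
  show "string_path C (SOME p. p \<in> a) \<in> paths (tilde_sset C)"
    using T.homotopy_paths[OF some[OF v(1)]] v(2) by simp
  show "R.holonomy (string_path C (SOME p. p \<in> a)) = a"
    using R.holonomy_homotopy[OF some[OF v(1)]] holonomy_string_path[OF v(1)] v(2) by simp
  fix b assume b: "b \<in> Arr (fractions C)" and ba: "Dom (fractions C) b = Cod (fractions C) a"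
  obtain y' w z where w': "composable C y' w z" "b = frac_class C y' w z"
    using b by (rule fractions_cases)
  have "y' = y" using ba v w' frac_class by simp
  then have w: "composable C y w z" "b = frac_class C y w z" using w' by simp_all
  have vw: "composable C x (v @ w) z" using v w composable_append by blast
  let ?s = "\<lambda>a. string_path C (SOME p. p \<in> a)"
  have "path_target (tilde_sset C) (string_path C (x, v, y)) =
      path_source (tilde_sset C) (string_path C (y, w, z))"
    using string_path[OF v(1)] string_path[OF w(1)] T.path_ends_in
    by (intro R.vert_inj) (simp_all del: string_path.simps)
  then have "(string_path C (x, v, y) @ string_path C (y, w, z), ?s a @ ?s b) \<in> homotopy (tilde_sset C)"
    unfolding v(2) w(2) by (intro T.homotopy_append some v(1) w(1))
  from T.homotopy_sym[OF this]
  have "(?s a @ ?s b, string_path C (x, v @ w, z)) \<in> homotopy (tilde_sset C)"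
    using homotopy_string_path_append[OF v(1) w(1)] by (rule T.homotopy_trans)
  then show "(?s a @ ?s b, ?s (Comp (fractions C) b a)) \<in> homotopy (tilde_sset C)"
    unfolding v(2) w(2) Comp_frac_class[OF v(1) w(1)] using some[OF vw] by (rule T.homotopy_trans)
next
  fix b assume b: "b \<in> simp (tilde_sset C) 1"
  let ?w = "[Fwd (snd b ({0}, {0, 1})), Bwd (snd b ({1}, {0, 1}))]"
  have "fst b {1} \<in> Obj C"
    using functors_order(1)[OF b[unfolded tilde_simplex_iff], of "{1}"] by simp
  then have c: "composable C (fst b {0}) ?w (fst b {1})"
    using tilde_arrow[OF b, of "{0}" "{0, 1}"] tilde_arrow[OF b, of "{1}" "{0, 1}"] by simp
  note p = map_letter_simplex[OF c]
  \<comment> \<open>The leading identity letter is the unit at the source and can be removed, as two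
    letters remain.\<close>
  have "(string_path C (fst b {0}, ?w, fst b {1}), map (letter_simplex C) ?w) \<in> homotopy (tilde_sset C)"
    using T.homotopy_unit_left[OF p(1)] degen_path_ends(2)[OF p(1)] p(2)
    by (simp del: letter_simplex.simps)
  moreover have "(map (letter_simplex C) ?w, [b]) \<in> homotopy (tilde_sset C)"
    using homotopy_cospan[OF b] by simp
  moreover have "(string_path C (fst b {0}, ?w, fst b {1}), string_path C (SOME p. p \<in> cospan_class C b))
      \<in> homotopy (tilde_sset C)"
    unfolding cospan_class_def by (rule homotopy_string_equiv[OF some_frac_class[OF c]])
  ultimately show "(string_path C (SOME p. p \<in> cospan_class C b), [b]) \<in> homotopy (tilde_sset C)"
    using T.homotopy_sym T.homotopy_trans by metis
qed

end

end

theorem theorem3p1: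
  fixes C :: "('o, 'a) precategory"
  assumes "category C"
  shows "isomorphic_groupoids (homotopy_groupoid (nerve (fractions C)))
           (homotopy_groupoid (tilde_sset C))"
proof -
  interpret category C by fact
  show ?thesis
    by (rule isomorphic_groupoids_common[OF
        groupoid.isomorphic_homotopy_groupoid_nerve[OF groupoid_fractions]
        isomorphic_homotopy_groupoid_tilde])
qed

end
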